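(* Assume the standing assumptions (A1) and (A2) below. Then the following hold. (i) For every $v \in C_p(\Omega_{\mathrm{loc}},\mathbb{R})$ there exists a measurable map $\mathbb{P}_0^*:\Omega_{\mathrm{loc}}\times A\to\mathcal{M}_1(\Omega_{\mathrm{loc}})$ such that for all $(x,a)\in\Omega_{\mathrm{loc}}\times A$ we have $\mathbb{P}_0^*(x,a)\in\mathcal{P}(x,a)$ and $$\int_{\Omega_{\mathrm{loc}}} \big(r(x,a,\omega_1)+\alpha v(\omega_1)\big)\,\mathbb{P}_0^*(x,a;d\omega_1)=\inf_{\mathbb{P}_0\in\mathcal{P}(x,a)}\mathbb{E}_{\mathbb{P}_0}\big[r(x,a,X_1)+\alpha v(X_1)\big].$$ Moreover, there exists $a_{\mathrm{loc}}^*\in\mathcal{A}_{\mathrm{loc}}$ such that for every $x\in\Omega_{\mathrm{loc}}$, $$\inf_{\mathbb{P}_0\in\mathcal{P}(x,a^*_{\mathrm{loc}}(x))}\mathbb{E}_{\mathbb{P}_0}\big[r(x,a^*_{\mathrm{loc}}(x),X_1)+\alpha v(X_1)\big]=\sup_{a_{\mathrm{loc}}\in\mathcal{A}_{\mathrm{loc}}}\inf_{\mathbb{P}_0\in\mathcal{P}(x,a_{\mathrm{loc}}(x))}\mathbb{E}_{\mathbb{P}_0}\big[r(x,a_{\mathrm{loc}}(x),X_1)+\alpha v(X_1)\big].$$ Furthermore, defining $\mathbb{P}^*_{\mathrm{loc}}(x):=\mathbb{P}_0^*(x,a^*_{\mathrm{loc}}(x))$ for $x\in\Omega_{\mathrm{loc}}$,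 we have $\mathbb{P}^*_{\mathrm{loc}}\in\mathbf{P}_{a^*_{\mathrm{loc}}}$ and for every $x\in\Omega_{\mathrm{loc}}$ $$\mathcal{T}v(x)=\sup_{a_{\mathrm{loc}}\in\mathcal{A}_{\mathrm{loc}}}\inf_{\mathbb{P}_0\in\mathbf{P}_{a_{\mathrm{loc}}}}\mathbb{E}_{\mathbb{P}_0(x)}\big[r(x,a_{\mathrm{loc}}(x),X_1)+\alpha v(X_1)\big]=\inf_{\mathbb{P}_0\in\mathbf{P}_{a^*_{\mathrm{loc}}}}\mathbb{E}_{\mathbb{P}_0(x)}\big[r(x,a^*_{\mathrm{loc}}(x),X_1)+\alpha v(X_1)\big]=\mathbb{E}_{\mathbb{P}^*_{\mathrm{loc}}(x)}\big[r(x,a^*_{\mathrm{loc}}(x),X_1)+\alpha v(X_1)\big].$$ (ii) $\mathcal{T}v\in C_p(\Omega_{\mathrm{loc}},\mathbb{R})$ for all $v\in C_p(\Omega_{\mathrm{loc}},\mathbb{R})$, and for all $v,w\in C_p(\Omega_{\mathrm{loc}},\mathbb{R})$, $$\|\mathcal{T}v-\mathcal{T}w\|_{C_p}\le \alpha C_P\|v-w\|_{C_p}.$$ In particular there is a unique $v\in C_p(\Omega_{\mathrm{loc}},\mathbb{R})$ with $\mathcal{T}v=v$, and for every $v_0\in C_p(\Omega_{\mathrm{loc}},\mathbb{R})$ one has $v=\lim_{n\to\infty}\mathcal{T}^n v_0$ in $\|\cdot\|_{C_p}$. (iii) Let $v\in C_p(\Omega_{\mathrm{loc}},\mathbb{R})$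 satisfy $\mathcal{T}v=v$, and let $a^*_{\mathrm{loc}}\in\mathcal{A}_{\mathrm{loc}}$ and $\mathbb{P}^*_{\mathrm{loc}}\in\mathbf{P}_{a^*_{\mathrm{loc}}}$ be as in (i) for this $v$. Define $\mathbf{a}^*:=(a^*_{\mathrm{loc}}(X_0),a^*_{\mathrm{loc}}(X_1),\dots)\in\mathcal{A}$ and, for $x\in\Omega_{\mathrm{loc}}$, $\mathbb{P}^*_x:=\delta_x\otimes\mathbb{P}^*_{\mathrm{loc}}\otimes\mathbb{P}^*_{\mathrm{loc}}\otimes\cdots\in\mathfrak{P}_{x,\mathbf{a}^*}$. Then for all $x\in\Omega_{\mathrm{loc}}$, $$\mathbb{E}_{\mathbb{P}^*_x}\Big[\sum_{t=0}^\infty\alpha^t r(X_t,a^*_{\mathrm{loc}}(X_t),X_{t+1})\Big]=\inf_{\mathbb{P}\in\mathfrak{P}_{x,\mathbf{a}^*}}\mathbb{E}_{\mathbb{P}}\Big[\sum_{t=0}^\infty\alpha^t r(X_t,a^*_{\mathrm{loc}}(X_t),X_{t+1})\Big]=V(x)=v(x).$$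
   Context: Setting. Let $d,m\in\mathbb{N}$, let $\Omega_{\mathrm{loc}}\subseteq\mathbb{R}^d$ be closed with Borel $\sigma$-field $\mathcal{F}_{\mathrm{loc}}$, and let $\Omega:=\Omega_{\mathrm{loc}}^{\mathbb{N}_0}$ with product $\sigma$-field $\mathcal{F}$. $X_t(\omega_0,\omega_1,\dots):=\omega_t$ is the canonical process. $\mathcal{M}_1(Y)$ denotes the Borel probability measures on $Y$; $\|\cdot\|$ is the Euclidean norm; $\delta_x$ is the Dirac measure at $x$. Let $A\subseteq\mathbb{R}^m$ be compact. The set of policies is $\mathcal{A}:=\{(a_t(X_t))_{t\in\mathbb{N}_0}: a_t:\Omega_{\mathrm{loc}}\to A \text{ Borel measurable for all } t\}$, and the set of one-step actions is $\mathcal{A}_{\mathrm{loc}}:=\{a_{\mathrm{loc}}:\Omega_{\mathrm{loc}}\to A\text{ measurable}\}$. For $X\subseteq\mathbb{R}^k$ and $p\in\mathbb{N}_0$, $C_p(X,\mathbb{R})$ is the set of continuous $g:X\to\mathbb{R}$ with $\sup_{x\in X}|g(x)|/(1+\|x\|^p)<\infty$; on $C_p(\Omega_{\mathrm{loc}},\mathbb{R})$ set $\|g\|_{C_p}:=\sup_{x\in\Omega_{\mathrm{loc}}}|g(x)|/(1+\|x\|^p)$. $\tau_p$ denotes the topology on $\mathcal{M}_1(\Omega_{\mathrm{loc}})$ in which $\mu_n\to\mu$ iff $\int g\,d\mu_n\to\int g\,d\mu$ for all $g\in C_p(\Omega_{\mathrm{loc}},\mathbb{R})$ ($\tau_0$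 = weak convergence, $\tau_1$ = Wasserstein-1 topology). A correspondence $\varphi:X\twoheadrightarrow Y$ between topological spaces is upper hemicontinuous if $\{x:\varphi(x)\subseteq U\}$ is open for every open $U$, lower hemicontinuous if $\{x:\varphi(x)\cap U\neq\emptyset\}$ is open for every open $U$, and continuous if both. Products of spaces carry the product topology. Standing assumption (A1). Fix $p\in\{0,1\}$. (i) The correspondence $\Omega_{\mathrm{loc}}\times A\ni(x,a)\twoheadrightarrow\mathcal{P}(x,a)\subseteq(\mathcal{M}_1(\Omega_{\mathrm{loc}}),\tau_p)$ is nonempty, compact-valued and continuous. (ii) There is $C_P\ge1$ such that $\int(1+\|y\|^p)\,\mathbb{P}(dy)\le C_P(1+\|x\|^p)$ for all $(x,a)$ and all $\mathbb{P}\in\mathcal{P}(x,a)$. Standing assumption (A2). $r:\Omega_{\mathrm{loc}}\times A\times\Omega_{\mathrm{loc}}\to\mathbb{R}$ satisfies: (i) $r$ is continuous; (ii) there exist $L>0$ and moduli of continuity $\rho_0,\rho_A:[0,\infty]\to[0,\infty]$ (i.e. $\lim_{s\to0}\rho(s)=0=\rho(0)$) with $|r(x_0,a,x_1)-r(x_0',a',x_1)|\le L(1+\|x_1\|^p)(\rho_0(\|x_0-x_0'\|)+\rho_A(\|a-a'\|))$ for all $x_0,x_0',x_1\in\Omega_{\mathrm{loc}}$, $a,a'\in A$; (iii) there is $C_r\ge1$ with $|r(x_0,a,x_1)|\le C_r(1+\|x_0\|^p+\|x_1\|^p)$ for all $x_0,x_1,a$; (iv) the discount factor $\alpha$ satisfies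 $0<\alpha<1/C_P$. Ambiguity sets. For $x\in\Omega_{\mathrm{loc}}$ and $\mathbf{a}=(a_t(X_t))_t\in\mathcal{A}$, $\mathfrak{P}_{x,\mathbf{a}}$ is the set of measures $\delta_x\otimes\mathbb{P}_0\otimes\mathbb{P}_1\otimes\cdots$ on $(\Omega,\mathcal{F})$, where each $\mathbb{P}_t:\Omega_{\mathrm{loc}}\to\mathcal{M}_1(\Omega_{\mathrm{loc}})$ is a Borel measurable kernel with $\mathbb{P}_t(\omega_t)\in\mathcal{P}(\omega_t,a_t(\omega_t))$ for all $\omega_t$, and $(\delta_x\otimes\mathbb{P}_0\otimes\mathbb{P}_1\otimes\cdots)(B):=\int\cdots\int \mathbf{1}_B((\omega_t)_t)\cdots\mathbb{P}_{t-1}(\omega_{t-1};d\omega_t)\cdots\mathbb{P}_0(\omega_0;d\omega_1)\delta_x(d\omega_0)$. For $a_{\mathrm{loc}}\in\mathcal{A}_{\mathrm{loc}}$, $\mathbf{P}_{a_{\mathrm{loc}}}:=\{\mathbb{P}_0:\Omega_{\mathrm{loc}}\to\mathcal{M}_1(\Omega_{\mathrm{loc}})\text{ measurable}:\mathbb{P}_0(x)\in\mathcal{P}(x,a_{\mathrm{loc}}(x))\ \forall x\}$. Value function and operator. $V(x):=\sup_{\mathbf{a}\in\mathcal{A}}\inf_{\mathbb{P}\in\mathfrak{P}_{x,\mathbf{a}}}\mathbb{E}_{\mathbb{P}}[\sum_{t=0}^\infty\alpha^t r(X_t,a_t,X_{t+1})]$. For $v\in C_p(\Omega_{\mathrm{loc}},\mathbb{R})$,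 $\mathcal{T}v(x):=\sup_{a\in A}\inf_{\mathbb{P}\in\mathcal{P}(x,a)}\mathbb{E}_{\mathbb{P}}[r(x,a,X_1)+\alpha v(X_1)]$, where $X_1$ denotes the identity on $\Omega_{\mathrm{loc}}$ under $\mathbb{P}\in\mathcal{M}_1(\Omega_{\mathrm{loc}})$. *)

theory Defs
  imports "HOL-Probability.Probability"
begin

abbreviation locsp :: "'x::euclidean_space set \<Rightarrow> 'x measure" where
  "locsp Om \<equiv> restrict_space borel Om"

definition M1 :: "'x::euclidean_space set \<Rightarrow> 'x measure set" where
  "M1 Om = {M. sets M = sets (locsp Om) \<and> prob_space M}"

definition Cp :: "nat \<Rightarrow> 'x::euclidean_space set \<Rightarrow> ('x \<Rightarrow> real) set" where
  "Cp p Om = {g. continuous_on Om g \<and> (\<exists>C. \<forall>x\<in>Om. \<bar>g x\<bar> \<le> C * (1 + norm x ^ p))}"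

definition cpnorm :: "nat \<Rightarrow> 'x::euclidean_space set \<Rightarrow> ('x \<Rightarrow> real) \<Rightarrow> real" where
  "cpnorm p Om g = (SUP x\<in>Om. \<bar>g x\<bar> / (1 + norm x ^ p))"

text \<open>Probability measures with finite p-th moment (all of M1 when p = 0); the
  topology tau_p lives on this set: it is the coarsest topology making all maps
  mu |-> integral g d mu, g in C_p, continuous.\<close>
definition M1p :: "nat \<Rightarrow> 'x::euclidean_space set \<Rightarrow> 'x measure set" where
  "M1p p Om = {M \<in> M1 Om. integrable M (\<lambda>y. norm y ^ p)}"

definition tau :: "nat \<Rightarrow> 'x::euclidean_space set \<Rightarrow> 'x measure topology" where
  "tau p Om = topology_generated_by
     {{M \<in> M1p p Om. integral\<^sup>L M g \<in> U} | g U. g \<in> Cp p Om \<and> open U}"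

definition uhc :: "'a topology \<Rightarrow> 'b topology \<Rightarrow> ('a \<Rightarrow> 'b set) \<Rightarrow> bool" where
  "uhc X Y \<phi> \<longleftrightarrow> (\<forall>U. openin Y U \<longrightarrow> openin X {z \<in> topspace X. \<phi> z \<subseteq> U})"

definition lhc :: "'a topology \<Rightarrow> 'b topology \<Rightarrow> ('a \<Rightarrow> 'b set) \<Rightarrow> bool" where
  "lhc X Y \<phi> \<longleftrightarrow> (\<forall>U. openin Y U \<longrightarrow> openin X {z \<in> topspace X. \<phi> z \<inter> U \<noteq> {}})"

definition Aloc :: "'x::euclidean_space set \<Rightarrow> 'u::euclidean_space set \<Rightarrow> ('x \<Rightarrow> 'u) set" where
  "Aloc Om A = measurable (locsp Om) (restrict_space borel A)"

text \<open>Policies (a_t(X_t))_t, represented by the sequence of maps a_t.\<close>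
definition Apol :: "'x::euclidean_space set \<Rightarrow> 'u::euclidean_space set \<Rightarrow> (nat \<Rightarrow> 'x \<Rightarrow> 'u) set" where
  "Apol Om A = {a. \<forall>t. a t \<in> Aloc Om A}"

definition Kset :: "'x::euclidean_space set \<Rightarrow> ('x \<Rightarrow> 'u \<Rightarrow> 'x measure set) \<Rightarrow> ('x \<Rightarrow> 'u)
    \<Rightarrow> ('x \<Rightarrow> 'x measure) set" where
  "Kset Om Pc a = {K \<in> measurable (locsp Om) (prob_algebra (locsp Om)). \<forall>x\<in>Om. K x \<in> Pc x (a x)}"

text \<open>Finite-dimensional distributions of delta_x (x) K_0 (x) K_1 (x) ... on the
  coordinates 0..n (K_t is the transition kernel from omega_t to omega_(t+1)).\<close>
fun fdd :: "'x::euclidean_space set \<Rightarrow> 'x \<Rightarrow> (nat \<Rightarrow> 'x \<Rightarrow> 'x measure) \<Rightarrow> nat \<Rightarrow> (nat \<Rightarrow> 'x) measure" where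
  "fdd Om x K 0 = distr (return (locsp Om) x) (PiM {..0} (\<lambda>_. locsp Om)) (\<lambda>y. (\<lambda>i\<in>{..0}. y))"
| "fdd Om x K (Suc n) = bind (fdd Om x K n)
      (\<lambda>\<omega>. distr (K n (\<omega> n)) (PiM {..Suc n} (\<lambda>_. locsp Om))
              (\<lambda>y. (\<lambda>i\<in>{..Suc n}. if i = Suc n then y else \<omega> i)))"

text \<open>The measure delta_x (x) K_0 (x) K_1 (x) ... on (Om^N, product sigma-field):
  the (unique) probability measure on the path space with these finite-dimensional
  distributions (Ionescu-Tulcea).\<close>
definition pathmeas :: "'x::euclidean_space set \<Rightarrow> 'x \<Rightarrow> (nat \<Rightarrow> 'x \<Rightarrow> 'x measure) \<Rightarrow> (nat \<Rightarrow> 'x) measure" where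
  "pathmeas Om x K = (THE M. sets M = sets (PiM UNIV (\<lambda>_. locsp Om)) \<and> prob_space M \<and>
      (\<forall>n. distr M (PiM {..n} (\<lambda>_. locsp Om)) (\<lambda>\<omega>. restrict \<omega> {..n}) = fdd Om x K n))"

definition Pfrak :: "'x::euclidean_space set \<Rightarrow> ('x \<Rightarrow> 'u \<Rightarrow> 'x measure set) \<Rightarrow> 'x
    \<Rightarrow> (nat \<Rightarrow> 'x \<Rightarrow> 'u) \<Rightarrow> (nat \<Rightarrow> 'x) measure set" where
  "Pfrak Om Pc x a = {pathmeas Om x K | K. \<forall>t. K t \<in> measurable (locsp Om) (prob_algebra (locsp Om))
                                              \<and> (\<forall>y\<in>Om. K t y \<in> Pc y (a t y))}"

definition stageval :: "('x \<Rightarrow> 'u \<Rightarrow> 'x \<Rightarrow> real) \<Rightarrow> real \<Rightarrow> ('x \<Rightarrow> real) \<Rightarrow> 'x \<Rightarrow> 'u \<Rightarrow> 'x measure \<Rightarrow> real" where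
  "stageval r \<alpha> v x a Q = integral\<^sup>L Q (\<lambda>y. r x a y + \<alpha> * v y)"

definition Tb :: "'u set \<Rightarrow> ('x \<Rightarrow> 'u \<Rightarrow> 'x measure set) \<Rightarrow> ('x \<Rightarrow> 'u \<Rightarrow> 'x \<Rightarrow> real) \<Rightarrow> real
    \<Rightarrow> ('x \<Rightarrow> real) \<Rightarrow> 'x \<Rightarrow> real" where
  "Tb A Pc r \<alpha> v x = (SUP a\<in>A. INF Q\<in>Pc x a. stageval r \<alpha> v x a Q)"

definition totrew :: "('x \<Rightarrow> 'u \<Rightarrow> 'x \<Rightarrow> real) \<Rightarrow> real \<Rightarrow> (nat \<Rightarrow> 'x \<Rightarrow> 'u) \<Rightarrow> (nat \<Rightarrow> 'x) \<Rightarrow> real" where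
  "totrew r \<alpha> a \<omega> = (\<Sum>t. \<alpha> ^ t * r (\<omega> t) (a t (\<omega> t)) (\<omega> (Suc t)))"

definition Vfun :: "'x::euclidean_space set \<Rightarrow> 'u::euclidean_space set \<Rightarrow> ('x \<Rightarrow> 'u \<Rightarrow> 'x measure set)
    \<Rightarrow> ('x \<Rightarrow> 'u \<Rightarrow> 'x \<Rightarrow> real) \<Rightarrow> real \<Rightarrow> 'x \<Rightarrow> real" where
  "Vfun Om A Pc r \<alpha> x = (SUP a\<in>Apol Om A. INF P\<in>Pfrak Om Pc x a. integral\<^sup>L P (totrew r \<alpha> a))"

definition optkernel :: "'x::euclidean_space set \<Rightarrow> 'u::euclidean_space set \<Rightarrow> ('x \<Rightarrow> 'u \<Rightarrow> 'x measure set)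
    \<Rightarrow> ('x \<Rightarrow> 'u \<Rightarrow> 'x \<Rightarrow> real) \<Rightarrow> real \<Rightarrow> ('x \<Rightarrow> real) \<Rightarrow> ('x \<times> 'u \<Rightarrow> 'x measure) \<Rightarrow> bool" where
  "optkernel Om A Pc r \<alpha> v P0 \<longleftrightarrow>
     P0 \<in> measurable (restrict_space borel (Om \<times> A)) (prob_algebra (locsp Om)) \<and>
     (\<forall>x\<in>Om. \<forall>a\<in>A. P0 (x, a) \<in> Pc x a \<and>
        stageval r \<alpha> v x a (P0 (x, a)) = (INF Q\<in>Pc x a. stageval r \<alpha> v x a Q))"

definition optaction :: "'x::euclidean_space set \<Rightarrow> 'u::euclidean_space set \<Rightarrow> ('x \<Rightarrow> 'u \<Rightarrow> 'x measure set)
    \<Rightarrow> ('x \<Rightarrow> 'u \<Rightarrow> 'x \<Rightarrow> real) \<Rightarrow> real \<Rightarrow> ('x \<Rightarrow> real) \<Rightarrow> ('x \<Rightarrow> 'u) \<Rightarrow> bool" where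
  "optaction Om A Pc r \<alpha> v as \<longleftrightarrow> as \<in> Aloc Om A \<and>
     (\<forall>x\<in>Om. (INF Q\<in>Pc x (as x). stageval r \<alpha> v x (as x) Q)
            = (SUP a'\<in>Aloc Om A. INF Q\<in>Pc x (a' x). stageval r \<alpha> v x (a' x) Q))"

end

theory Submission
  imports Defs
begin

text \<open>
  Berge's maximum theorem makes the inner infimum continuous in state and action and \<open>\<T> v\<close>
  continuous in the state; (A1)(ii) makes \<open>\<T>\<close> a contraction for the weighted norm.
  Measurable minimisers are obtained without a general selection theorem: minimise the objective
  over the compact set \<open>\<P>(x,a)\<close>, then, among its minimisers, successively the integrals of a
  countable family of continuous functions that determines measurability of kernels. Each iterated
  minimum is a limit of penalised minima \<open>INF (h + k f) - k INF f\<close> over the previous set, hence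
  measurable, and compactness leaves a common minimiser. The same argument, with the coordinates of
  \<open>a\<close> in place of the integrals, selects the optimal action.
  For (iii), the path measures are Ionescu-Tulcea limits. For any \<open>v \<in> Cp p Om\<close>, the expected total
  reward minus \<open>v(x)\<close> is the discounted sum of the expected Bellman residuals
  \<open>E[r(X\<^sub>t, a\<^sub>t, X\<^sub>t\<^sub>+\<^sub>1) + \<alpha> v(X\<^sub>t\<^sub>+\<^sub>1) - v(X\<^sub>t)]\<close>. If \<open>v = \<T> v\<close>, these are nonnegative for the optimal
  action under every admissible kernel, and nonpositive for every action under the minimising kernel.
\<close>

section \<open>Continuous correspondences\<close>

lemma compactin_attains_INF:
  fixes f :: "'y \<Rightarrow> real"
  assumes "compactin Y S" "S \<noteq> {}" "continuous_map Y euclideanreal f"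
  obtains y where "y \<in> S" "f y = (INF y\<in>S. f y)"
proof -
  have "compact (f ` S)"
    using image_compactin[OF assms(1,3)] by simp
  then obtain y where "y \<in> S" "\<And>y'. y' \<in> S \<Longrightarrow> f y \<le> f y'"
    using compact_attains_inf[of "f ` S"] assms(2) by auto
  then have "y \<in> S" "(INF y\<in>S. f y) = f y"
    by (auto intro!: cInf_eq_minimum)
  then show thesis using that by simp
qed

lemma compactin_INF_lower:
  fixes f :: "'y \<Rightarrow> real"
  assumes "compactin Y S" "continuous_map Y euclideanreal f" "y \<in> S"
  shows "(INF y\<in>S. f y) \<le> f y"
  using image_compactin[OF assms(1,2)] assms(3)
  by (intro cINF_lower) (auto intro: bounded_imp_bdd_below compact_imp_bounded)

lemma compactin_less_INF_iff:
  fixes f :: "'y \<Rightarrow> real"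
  assumes "compactin Y S" "S \<noteq> {}" "continuous_map Y euclideanreal f"
  shows "a < (INF y\<in>S. f y) \<longleftrightarrow> (\<forall>y\<in>S. a < f y)"
  using compactin_attains_INF[OF assms] compactin_INF_lower[OF assms(1,3)] by (metis less_le_trans)

lemma compactin_INF_less_iff:
  fixes f :: "'y \<Rightarrow> real"
  assumes "compactin Y S" "S \<noteq> {}" "continuous_map Y euclideanreal f"
  shows "(INF y\<in>S. f y) < a \<longleftrightarrow> (\<exists>y\<in>S. f y < a)"
  using compactin_attains_INF[OF assms] compactin_INF_lower[OF assms(1,3)] by (metis le_less_trans)

lemma continuous_map_prod_slice:
  assumes "continuous_map (prod_topology X Y) Z (case_prod f)" "x \<in> topspace X"
  shows "continuous_map Y Z (f x)"
proof -
  have "continuous_map Y (prod_topology X Y) (\<lambda>y. (x, y))"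
    using assms(2) by (simp add: continuous_map_pairedI)
  from continuous_map_compose[OF this assms(1)] show ?thesis
    by (simp add: comp_def)
qed

locale continuous_correspondence =
  fixes X :: "'x topology" and Y :: "'y topology" and \<phi> :: "'x \<Rightarrow> 'y set"
  assumes uhc: "uhc X Y \<phi>" and lhc: "lhc X Y \<phi>"
    and compactin_values: "x \<in> topspace X \<Longrightarrow> compactin Y (\<phi> x)"
    and nonempty_values: "x \<in> topspace X \<Longrightarrow> \<phi> x \<noteq> {}"

lemma continuous_correspondence_const:
  assumes "compactin Y S" "S \<noteq> {}"
  shows "continuous_correspondence X Y (\<lambda>_. S)"
proof
  have const: "{x \<in> topspace X. b} = (if b then topspace X else {})" for b by simp
  show "uhc X Y (\<lambda>_. S)" "lhc X Y (\<lambda>_. S)"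
    unfolding uhc_def lhc_def const by simp_all
qed (use assms in simp_all)

context continuous_correspondence
begin

lemma openin_values_subset:
  assumes W: "openin (prod_topology X Y) W"
  shows "openin X {x \<in> topspace X. \<forall>y\<in>\<phi> x. (x, y) \<in> W}"
proof (subst openin_subopen, intro ballI)
  fix x assume "x \<in> {x \<in> topspace X. \<forall>y\<in>\<phi> x. (x, y) \<in> W}"
  then have x: "x \<in> topspace X" "{x} \<times> \<phi> x \<subseteq> W" by auto
  obtain U V where UV: "openin X U" "openin Y V" "x \<in> U" "\<phi> x \<subseteq> V" "U \<times> V \<subseteq> W"
    using tube_lemma_right[OF W compactin_values[OF x(1)] x] by metis
  have "openin X (U \<inter> {x \<in> topspace X. \<phi> x \<subseteq> V})"
    using uhc UV by (intro openin_Int) (auto simp: uhc_def)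
  moreover have "x \<in> U \<inter> {x \<in> topspace X. \<phi> x \<subseteq> V}"
    using x UV by auto
  moreover have "U \<inter> {x \<in> topspace X. \<phi> x \<subseteq> V} \<subseteq> {x \<in> topspace X. \<forall>y\<in>\<phi> x. (x, y) \<in> W}"
    using UV by blast
  ultimately show "\<exists>T. openin X T \<and> x \<in> T \<and> T \<subseteq> {x \<in> topspace X. \<forall>y\<in>\<phi> x. (x, y) \<in> W}"
    by blast
qed

lemma openin_values_meet:
  assumes W: "openin (prod_topology X Y) W"
  shows "openin X {x \<in> topspace X. \<exists>y\<in>\<phi> x. (x, y) \<in> W}"
proof (subst openin_subopen, intro ballI)
  fix x assume "x \<in> {x \<in> topspace X. \<exists>y\<in>\<phi> x. (x, y) \<in> W}"
  then obtain y where x: "x \<in> topspace X" "y \<in> \<phi> x" "(x, y) \<in> W" by auto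
  obtain U V where UV: "openin X U" "openin Y V" "x \<in> U" "y \<in> V" "U \<times> V \<subseteq> W"
    using W x(3) unfolding openin_prod_topology_alt by metis
  have "openin X (U \<inter> {x \<in> topspace X. \<phi> x \<inter> V \<noteq> {}})"
    using lhc UV by (intro openin_Int) (auto simp: lhc_def)
  moreover have "x \<in> U \<inter> {x \<in> topspace X. \<phi> x \<inter> V \<noteq> {}}"
    using x UV by auto
  moreover have "U \<inter> {x \<in> topspace X. \<phi> x \<inter> V \<noteq> {}} \<subseteq> {x \<in> topspace X. \<exists>y\<in>\<phi> x. (x, y) \<in> W}"
    using UV by blast
  ultimately show "\<exists>T. openin X T \<and> x \<in> T \<and> T \<subseteq> {x \<in> topspace X. \<exists>y\<in>\<phi> x. (x, y) \<in> W}"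
    by blast
qed

theorem Berge_continuous_map_INF:
  fixes f :: "'x \<Rightarrow> 'y \<Rightarrow> real"
  assumes f: "continuous_map (prod_topology X Y) euclideanreal (case_prod f)"
  shows "continuous_map X euclideanreal (\<lambda>x. INF y\<in>\<phi> x. f x y)"
proof -
  let ?lower = "\<lambda>a. {z \<in> topspace (prod_topology X Y). case_prod f z \<in> {..<a}}"
  let ?upper = "\<lambda>a. {z \<in> topspace (prod_topology X Y). case_prod f z \<in> {a<..}}"
  have in_topspace: "y \<in> topspace Y" if "x \<in> topspace X" "y \<in> \<phi> x" for x y
    using compactin_subset_topspace[OF compactin_values] that by blast
  note slices = compactin_values nonempty_values continuous_map_prod_slice[OF f]
  have "{x \<in> topspace X. a < (INF y\<in>\<phi> x. f x y)} = {x \<in> topspace X. \<forall>y\<in>\<phi> x. (x, y) \<in> ?upper a}" for a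
    using in_topspace by (auto simp: compactin_less_INF_iff[OF slices])
  moreover have "openin X {x \<in> topspace X. \<forall>y\<in>\<phi> x. (x, y) \<in> ?upper a}" for a
    by (intro openin_values_subset openin_continuous_map_preimage[OF f]) simp
  moreover have "{x \<in> topspace X. (INF y\<in>\<phi> x. f x y) < a} = {x \<in> topspace X. \<exists>y\<in>\<phi> x. (x, y) \<in> ?lower a}" for a
    using in_topspace by (auto simp: compactin_INF_less_iff[OF slices])
  moreover have "openin X {x \<in> topspace X. \<exists>y\<in>\<phi> x. (x, y) \<in> ?lower a}" for a
    by (intro openin_values_meet openin_continuous_map_preimage[OF f]) simp
  ultimately show ?thesis
    unfolding continuous_map_upper_lower_semicontinuous_lt by simp
qed

end

section \<open>Measurable selection by lexicographic minimisation\<close>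

definition argmin_on :: "('y \<Rightarrow> real) \<Rightarrow> 'y set \<Rightarrow> 'y set" where
  "argmin_on f S = {y \<in> S. f y = (INF y\<in>S. f y)}"

primrec lex_argmin :: "(nat \<Rightarrow> 'y \<Rightarrow> real) \<Rightarrow> 'y set \<Rightarrow> nat \<Rightarrow> 'y set" where
  "lex_argmin f S 0 = S"
| "lex_argmin f S (Suc n) = argmin_on (f n) (lex_argmin f S n)"

lemma argmin_on_subset: "argmin_on f S \<subseteq> S"
  by (auto simp: argmin_on_def)

lemma argmin_on_nonempty:
  assumes "compactin Y S" "S \<noteq> {}" "continuous_map Y euclideanreal f"
  shows "argmin_on f S \<noteq> {}"
  using compactin_attains_INF[OF assms] unfolding argmin_on_def by blast

lemma closedin_subtopology_continuous_map_Collect: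
  assumes "continuous_map Y euclideanreal f" "S \<subseteq> topspace Y" "closed C"
  shows "closedin (subtopology Y S) {y \<in> S. f y \<in> C}"
proof -
  have "{y \<in> S. f y \<in> C} = {y \<in> topspace (subtopology Y S). f y \<in> C}"
    using assms(2) by auto
  also have "closedin (subtopology Y S) \<dots>"
    using assms by (intro closedin_continuous_map_preimage[of _ euclideanreal]
      continuous_map_from_subtopology) simp_all
  finally show ?thesis .
qed

lemma closedin_lex_argmin:
  assumes S: "S \<subseteq> topspace Y" and f: "\<And>n. continuous_map Y euclideanreal (f n)"
  shows "closedin (subtopology Y S) (lex_argmin f S n)"
proof (induction n)
  case 0
  show ?case using S by simp
next
  case (Suc n)
  let ?m = "INF y\<in>lex_argmin f S n. f n y"
  have "lex_argmin f S n \<subseteq> S"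
    using Suc closedin_subset by fastforce
  then have "lex_argmin f S (Suc n) = lex_argmin f S n \<inter> {y \<in> S. f n y \<in> {?m}}"
    by (auto simp: argmin_on_def)
  then show ?case
    using closedin_subtopology_continuous_map_Collect[OF f S closed_singleton] Suc by (simp add: closedin_Int)
qed

lemma compactin_lex_argmin:
  assumes "compactin Y S" "\<And>n. continuous_map Y euclideanreal (f n)"
  shows "compactin Y (lex_argmin f S n)"
  using closedin_compact_space[OF compact_space_subtopology closedin_lex_argmin] assms
  by (meson compactin_subspace compactin_subtopology)

lemma lex_argmin_nonempty:
  assumes "compactin Y S" "S \<noteq> {}" "\<And>n. continuous_map Y euclideanreal (f n)"
  shows "lex_argmin f S n \<noteq> {}"
proof (induction n)
  case (Suc n)
  then show ?case
    using argmin_on_nonempty[OF compactin_lex_argmin[OF assms(1,3)] _ assms(3)] by simp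
qed (simp add: assms)

lemma INT_lex_argmin_nonempty:
  assumes S: "compactin Y S" "S \<noteq> {}" and f: "\<And>n. continuous_map Y euclideanreal (f n)"
  shows "(\<Inter>n. lex_argmin f S n) \<noteq> {}"
proof (rule compact_space_imp_nest)
  show "compact_space (subtopology Y S)" using S(1) by (rule compact_space_subtopology)
  show "closedin (subtopology Y S) (lex_argmin f S n)" for n
    by (rule closedin_lex_argmin[OF compactin_subset_topspace[OF S(1)] f])
  show "lex_argmin f S n \<noteq> {}" for n by (rule lex_argmin_nonempty[OF assms])
  show "decseq (lex_argmin f S)"
    by (rule decseq_SucI) (simp add: argmin_on_subset)
qed

lemma eventually_penalty_gt:
  fixes f h :: "'y \<Rightarrow> real"
  assumes S: "compactin Y S" and f: "continuous_map Y euclideanreal f" and h: "continuous_map Y euclideanreal h"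
    and f_ge: "\<And>y. y \<in> S \<Longrightarrow> m \<le> f y" and h_gt: "\<And>y. y \<in> S \<Longrightarrow> f y = m \<Longrightarrow> c < h y"
  shows "\<forall>\<^sub>F k in sequentially. \<forall>y\<in>S. c < h y + real k * (f y - m)"
proof -
  define T where "T k = {y \<in> S. h y + real k * (f y - m) \<in> {..c}}" for k
  have mono: "real k * (f y - m) \<le> real l * (f y - m)" if "k \<le> l" "y \<in> S" for k l y
    using that f_ge by (intro mult_right_mono) auto
  have "\<exists>k. T k = {}"
  proof (rule ccontr)
    assume "\<nexists>k. T k = {}"
    then have "(\<Inter>k. T k) \<noteq> {}"
    proof (intro compact_space_imp_nest[OF compact_space_subtopology[OF S]])
      have "continuous_map Y euclideanreal (\<lambda>y. h y + real k * (f y - m))" for k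
        by (intro continuous_intros f h) simp
      then show "closedin (subtopology Y S) (T k)" for k
        unfolding T_def by (rule closedin_subtopology_continuous_map_Collect)
          (use S compactin_subset_topspace in auto)
      show "decseq T"
        unfolding T_def decseq_def using mono by fastforce
    qed auto
    then obtain y where y: "y \<in> S" "\<And>k. h y + real k * (f y - m) \<le> c"
      by (auto simp: T_def)
    have "f y = m"
    proof (rule ccontr)
      assume "f y \<noteq> m"
      with f_ge[OF y(1)] obtain k where "c - h y < real k * (f y - m)"
        using reals_Archimedean3[of "f y - m"] by auto
      with y(2)[of k] show False by simp
    qed
    with h_gt[of y] y(1) y(2)[of 0] show False by simp
  qed
  then obtain N where N: "T N = {}" ..
  show ?thesis
  proof (intro eventually_sequentiallyI ballI)
    fix k y assume "N \<le> k" "y \<in> S"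
    then show "c < h y + real k * (f y - m)"
      using N mono[of N k y] unfolding T_def by fastforce
  qed
qed

lemma tendsto_INF_penalty:
  fixes f h :: "'y \<Rightarrow> real"
  assumes S: "compactin Y S" "S \<noteq> {}"
    and f: "continuous_map Y euclideanreal f" and h: "continuous_map Y euclideanreal h"
  shows "(\<lambda>k. (INF y\<in>S. h y + real k * f y) - real k * (INF y\<in>S. f y)) \<longlonglongrightarrow> (INF y\<in>argmin_on f S. h y)"
    (is "?v \<longlonglongrightarrow> ?I")
proof -
  let ?m = "INF y\<in>S. f y"
  have argmin: "compactin Y (argmin_on f S)" "argmin_on f S \<noteq> {}"
    using compactin_lex_argmin[where f = "\<lambda>_. f" and n = "Suc 0", OF S(1) f]
      argmin_on_nonempty[OF S f] by simp_all
  have penalty: "continuous_map Y euclideanreal (\<lambda>y. h y + real k * f y)" for k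
    by (intro continuous_intros f h)
  obtain y where "y \<in> argmin_on f S" "h y = ?I"
    using compactin_attains_INF[OF argmin h] by metis
  then have y: "y \<in> S" "f y = ?m" "h y = ?I" by (auto simp: argmin_on_def)
  have upper: "?v k \<le> ?I" for k
    using compactin_INF_lower[OF S(1) penalty y(1), of k] y(2,3) by simp
  show ?thesis
  proof (rule order_tendstoI)
    fix c assume "?I < c"
    then show "\<forall>\<^sub>F k in sequentially. ?v k < c"
      by (intro always_eventually allI le_less_trans[OF upper])
  next
    fix c assume "c < ?I"
    then have "c < h y" if "y \<in> S" "f y = ?m" for y
      using compactin_INF_lower[OF argmin(1) h] that by (fastforce simp: argmin_on_def)
    with compactin_INF_lower[OF S(1) f]
    have "\<forall>\<^sub>F k in sequentially. \<forall>y\<in>S. c < h y + real k * (f y - ?m)"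
      by (intro eventually_penalty_gt[OF S(1) f h])
    then show "\<forall>\<^sub>F k in sequentially. c < ?v k"
    proof eventually_elim
      case (elim k)
      obtain y where "y \<in> S" "h y + real k * f y = (INF y\<in>S. h y + real k * f y)"
        using compactin_attains_INF[OF S penalty] by metis
      then show ?case
        using elim by (auto simp: right_diff_distrib)
    qed
  qed
qed

context continuous_correspondence
begin

lemma borel_measurable_INF_lex_argmin:
  fixes f :: "nat \<Rightarrow> 'x \<Rightarrow> 'y \<Rightarrow> real"
  assumes M: "space M = topspace X" "\<And>g. continuous_map X euclideanreal g \<Longrightarrow> g \<in> borel_measurable M"
    and f: "\<And>n. continuous_map (prod_topology X Y) euclideanreal (case_prod (f n))"
    and h: "continuous_map (prod_topology X Y) euclideanreal (case_prod h)"
  shows "(\<lambda>x. INF y\<in>lex_argmin (\<lambda>i. f i x) (\<phi> x) n. h x y) \<in> borel_measurable M"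
  using h
proof (induction n arbitrary: h)
  case 0
  then show ?case by (simp add: M(2) Berge_continuous_map_INF)
next
  case (Suc n)
  let ?L = "\<lambda>x. lex_argmin (\<lambda>i. f i x) (\<phi> x) n"
  have "continuous_map (prod_topology X Y) euclideanreal (\<lambda>z. case_prod h z + real k * case_prod (f n) z)" for k
    by (intro continuous_intros Suc.prems f)
  then have [measurable]: "(\<lambda>x. INF y\<in>?L x. h x y + real k * f n x y) \<in> borel_measurable M" for k
    by (intro Suc.IH) (simp add: case_prod_beta')
  have [measurable]: "(\<lambda>x. INF y\<in>?L x. f n x y) \<in> borel_measurable M"
    by (rule Suc.IH[OF f])
  show ?case
  proof (rule borel_measurable_LIMSEQ_real)
    fix x assume "x \<in> space M"
    then have x: "x \<in> topspace X" by (simp add: M(1))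
    note slice = continuous_map_prod_slice[OF _ x]
    have "compactin Y (?L x)" "?L x \<noteq> {}"
      by (intro compactin_lex_argmin lex_argmin_nonempty[of Y] compactin_values nonempty_values slice[OF f] x)+
    then show "(\<lambda>k. (INF y\<in>?L x. h x y + real k * f n x y) - real k * (INF y\<in>?L x. f n x y))
        \<longlonglongrightarrow> (INF y\<in>lex_argmin (\<lambda>i. f i x) (\<phi> x) (Suc n). h x y)"
      unfolding lex_argmin.simps by (rule tendsto_INF_penalty[OF _ _ slice[OF f] slice[OF Suc.prems]])
  qed measurable
qed

theorem measurable_argmin_selection:
  fixes f :: "nat \<Rightarrow> 'x \<Rightarrow> 'y \<Rightarrow> real"
  assumes M: "space M = topspace X" "\<And>g. continuous_map X euclideanreal g \<Longrightarrow> g \<in> borel_measurable M"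
    and f: "\<And>n. continuous_map (prod_topology X Y) euclideanreal (case_prod (f n))"
  shows "\<exists>s. (\<forall>x\<in>topspace X. s x \<in> \<phi> x \<and> f 0 x (s x) = (INF y\<in>\<phi> x. f 0 x y)) \<and>
    (\<forall>n. (\<lambda>x. f n x (s x)) \<in> borel_measurable M)"
proof -
  let ?L = "\<lambda>x. lex_argmin (\<lambda>i. f i x) (\<phi> x)"
  have "\<exists>y. \<forall>n. y \<in> ?L x n" if "x \<in> topspace X" for x
  proof -
    have "(\<Inter>n. ?L x n) \<noteq> {}"
      using that by (intro INT_lex_argmin_nonempty[of Y] compactin_values
        nonempty_values continuous_map_prod_slice[OF f])
    then show ?thesis by blast
  qed
  then obtain s where s: "\<And>x n. x \<in> topspace X \<Longrightarrow> s x \<in> ?L x n"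
    by metis
  have attains: "f n x (s x) = (INF y\<in>?L x n. f n x y)" if "x \<in> topspace X" for n x
    using s[OF that, of "Suc n"] by (simp add: argmin_on_def)
  show ?thesis
  proof (intro exI[of _ s] conjI ballI allI)
    show "s x \<in> \<phi> x" "f 0 x (s x) = (INF y\<in>\<phi> x. f 0 x y)" if "x \<in> topspace X" for x
      using s[OF that, of 0] attains[OF that, of 0] by simp_all
    show "(\<lambda>x. f n x (s x)) \<in> borel_measurable M" for n
      using borel_measurable_INF_lex_argmin[OF M f f]
      by (subst measurable_cong[OF attains]) (simp_all add: M(1))
  qed
qed

end

section \<open>Kernels and their integrals\<close>

lemma borel_measurable_continuous_map_restrict:
  "continuous_map (top_of_set Z) euclideanreal g \<Longrightarrow> g \<in> borel_measurable (restrict_space borel Z)"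
  by (simp add: borel_measurable_continuous_on_restrict)

lemma countable_Int_stable_generator_borel:
  obtains G :: "'a::second_countable_topology set set"
  where "countable G" "G \<noteq> {}" "\<And>U. U \<in> G \<Longrightarrow> open U" "Int_stable G" "sets borel = sigma_sets UNIV G"
proof -
  obtain B :: "'a set set" where B: "countable B" "topological_basis B"
    using ex_countable_basis by blast
  define G where "G = Inter ` {F. finite F \<and> F \<subseteq> B}"
  have countable: "countable G"
    unfolding G_def by (intro countable_image countable_Collect_finite_subset B)
  have "open U" if "U \<in> G" for U
    using that by (auto simp: G_def intro: topological_basis_open[OF B(2)])
  moreover have "B \<subseteq> G"
    unfolding G_def by (auto intro!: image_eqI[of _ _ "{_}"])
  ultimately have "topological_basis G"
    using B(2) unfolding topological_basis_def by (meson subset_trans)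
  then have "sets borel = sigma_sets UNIV G"
    using borel_eq_countable_basis[OF countable] sets_measure_of[of G UNIV] by (metis Pow_UNIV top_greatest)
  moreover have "Int_stable G"
  proof (rule Int_stableI)
    fix U V assume "U \<in> G" "V \<in> G"
    then obtain E F where "finite E" "E \<subseteq> B" "U = \<Inter>E" "finite F" "F \<subseteq> B" "V = \<Inter>F"
      by (auto simp: G_def)
    then show "U \<inter> V \<in> G"
      unfolding G_def by (intro image_eqI[of _ _ "E \<union> F"]) auto
  qed
  moreover have "G \<noteq> {}" by (auto simp: G_def)
  ultimately show thesis using that countable \<open>\<And>U. U \<in> G \<Longrightarrow> open U\<close> by blast
qed

lemma continuous_tendsto_indicator_open:
  fixes U :: "'a::metric_space set"
  assumes "open U"
  obtains g :: "nat \<Rightarrow> 'a \<Rightarrow> real"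
  where "\<And>k. continuous_on UNIV (g k)" "\<And>k x. \<bar>g k x\<bar> \<le> 1" "\<And>x. (\<lambda>k. g k x) \<longlonglongrightarrow> indicator U x"
proof (cases "U = UNIV")
  case True
  show thesis by (rule that[of "\<lambda>_ _. 1"]) (auto simp: True)
next
  case False
  define g where "g k x = min 1 (real k * infdist x (- U))" for k x
  show thesis
  proof (rule that[of g])
    show "continuous_on UNIV (g k)" for k
      unfolding g_def by (intro continuous_intros)
    show "\<bar>g k x\<bar> \<le> 1" for k x
      by (simp add: g_def infdist_nonneg)
    show "(\<lambda>k. g k x) \<longlonglongrightarrow> indicator U x" for x
    proof (cases "x \<in> U")
      case True
      then have "0 < infdist x (- U)"
        using assms False infdist_pos_not_in_closed[of "- U" x] by auto
      then obtain n where n: "1 < real n * infdist x (- U)"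
        using reals_Archimedean3 by blast
      have "1 \<le> real k * infdist x (- U)" if "n \<le> k" for k
        using n mult_right_mono[of "real n" "real k" "infdist x (- U)"]
          that infdist_nonneg[of x "- U"] by linarith
      then have "\<forall>\<^sub>F k in sequentially. 1 \<le> real k * infdist x (- U)"
        by (rule eventually_sequentiallyI)
      then have "\<forall>\<^sub>F k in sequentially. g k x = indicator U x"
        using True by (auto simp: g_def elim: eventually_mono)
      then show ?thesis by (rule tendsto_eventually)
    qed (simp add: g_def)
  qed
qed

lemma measurable_prob_algebra_integral_generated:
  fixes K :: "'z \<Rightarrow> 'a measure"
  assumes N: "sets N = sigma_sets \<Omega> G" "Int_stable G" "G \<subseteq> Pow \<Omega>"
    and K: "\<And>z. z \<in> space M \<Longrightarrow> prob_space (K z)" "\<And>z. z \<in> space M \<Longrightarrow> sets (K z) = sets N"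
    and approx: "\<And>A. A \<in> G \<Longrightarrow> \<exists>g :: nat \<Rightarrow> 'a \<Rightarrow> real. (\<forall>k. g k \<in> borel_measurable N) \<and> (\<forall>k x. \<bar>g k x\<bar> \<le> 1) \<and>
      (\<forall>x\<in>space N. (\<lambda>k. g k x) \<longlonglongrightarrow> indicator A x) \<and> (\<forall>k. (\<lambda>z. \<integral>y. g k y \<partial>K z) \<in> borel_measurable M)"
  shows "K \<in> measurable M (prob_algebra N)"
proof (rule measurable_prob_algebra_generated[OF N K])
  fix A assume A: "A \<in> G"
  then have A_sets: "A \<in> sets N" by (simp add: N(1))
  obtain g :: "nat \<Rightarrow> 'a \<Rightarrow> real"
    where g: "\<And>k. g k \<in> borel_measurable N" "\<And>k x. \<bar>g k x\<bar> \<le> 1"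
      "\<And>x. x \<in> space N \<Longrightarrow> (\<lambda>k. g k x) \<longlonglongrightarrow> indicator A x"
      "\<And>k. (\<lambda>z. \<integral>y. g k y \<partial>K z) \<in> borel_measurable M"
    using approx[OF A] by blast
  have "(\<lambda>z. measure (K z) A) \<in> borel_measurable M"
  proof (rule borel_measurable_LIMSEQ_real)
    fix z assume z: "z \<in> space M"
    interpret prob_space "K z" by (rule K(1)[OF z])
    note [measurable_cong] = K(2)[OF z]
    note [measurable] = g(1) A_sets
    have "(\<lambda>k. \<integral>y. g k y \<partial>K z) \<longlonglongrightarrow> (\<integral>y. indicator A y \<partial>K z)"
    proof (rule integral_dominated_convergence[where w = "\<lambda>_. 1"])
      show "AE y in K z. (\<lambda>k. g k y) \<longlonglongrightarrow> indicator A y"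
        using g(3) sets_eq_imp_space_eq[OF K(2)[OF z]] by auto
    qed (auto simp: g(2))
    then show "(\<lambda>k. \<integral>y. g k y \<partial>K z) \<longlonglongrightarrow> measure (K z) A"
      using sets.sets_into_space[of A "K z"] A_sets K(2)[OF z] by (simp add: Int_absorb2)
  qed (rule g(4))
  then have "(\<lambda>z. ennreal (measure (K z) A)) \<in> borel_measurable M"
    by measurable
  then show "(\<lambda>z. emeasure (K z) A) \<in> borel_measurable M"
    using K(1) by (subst measurable_cong[OF finite_measure.emeasure_eq_measure])
      (auto intro: prob_space.finite_measure)
qed

lemma countable_continuous_approx_generator_borel:
  obtains G :: "'a::{metric_space, second_countable_topology} set set" and g :: "nat \<Rightarrow> 'a \<Rightarrow> real"
  where "Int_stable G" "sets borel = sigma_sets UNIV G" "\<And>n. continuous_on UNIV (g n)" "\<And>n x. \<bar>g n x\<bar> \<le> 1"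
    "\<And>U. U \<in> G \<Longrightarrow> \<exists>i. \<forall>x. (\<lambda>k. g (i k) x) \<longlonglongrightarrow> indicator U x"
proof -
  obtain G :: "'a set set" where G: "countable G" "G \<noteq> {}" "\<And>U. U \<in> G \<Longrightarrow> open U"
      "Int_stable G" "sets borel = sigma_sets UNIV G"
    by (rule countable_Int_stable_generator_borel) blast
  have "\<exists>h. (\<forall>k. continuous_on UNIV (h k)) \<and> (\<forall>k x. \<bar>h k x\<bar> \<le> 1) \<and>
      (\<forall>x. (\<lambda>k. h k x) \<longlonglongrightarrow> (indicator U x :: real))" if "U \<in> G" for U
    using continuous_tendsto_indicator_open[OF G(3)[OF that]] by metis
  then obtain h where h: "\<And>U k. U \<in> G \<Longrightarrow> continuous_on UNIV (h U k)" "\<And>U k x. U \<in> G \<Longrightarrow> \<bar>h U k x\<bar> \<le> 1"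
      "\<And>U x. U \<in> G \<Longrightarrow> (\<lambda>k. h U k x) \<longlonglongrightarrow> (indicator U x :: real)"
    by metis
  let ?index = "from_nat_into (G \<times> (UNIV :: nat set))"
  define g where "g n = case_prod h (?index n)" for n
  have index: "fst (?index n) \<in> G" for n
    using from_nat_into[of "G \<times> (UNIV :: nat set)" n] G(2) by (simp add: mem_Times_iff)
  have enumerated: "\<exists>n. g n = h U k" if "U \<in> G" for U k
  proof -
    have "countable (G \<times> (UNIV :: nat set))" "(U, k) \<in> G \<times> (UNIV :: nat set)"
      using G(1) that by simp_all
    from from_nat_into_surj[OF this] obtain n where "?index n = (U, k)" ..
    then have "g n = h U k" by (simp add: g_def)
    then show ?thesis ..
  qed
  show thesis
  proof (rule that[OF G(4,5)])
    show "continuous_on UNIV (g n)" "\<bar>g n x\<bar> \<le> 1" for n x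
      using h(1,2)[OF index] by (simp_all add: g_def case_prod_beta')
    fix U assume U: "U \<in> G"
    then obtain i where "\<And>k. g (i k) = h U k" using enumerated by metis
    then show "\<exists>i. \<forall>x. (\<lambda>k. g (i k) x) \<longlonglongrightarrow> indicator U x"
      using h(3)[OF U] by (intro exI[of _ i]) simp
  qed
qed

lemma Int_stable_Int_image: "Int_stable G \<Longrightarrow> Int_stable ((\<inter>) S ` G)"
proof (rule Int_stableI)
  fix A B assume G: "Int_stable G" and "A \<in> (\<inter>) S ` G" "B \<in> (\<inter>) S ` G"
  then obtain U V where "U \<in> G" "V \<in> G" "A \<inter> B = S \<inter> (U \<inter> V)" by auto
  then show "A \<inter> B \<in> (\<inter>) S ` G"
    using G by (auto simp: Int_stable_def)
qed

lemma continuous_functions_determine_kernels: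
  fixes S :: "'a::{metric_space, second_countable_topology} set"
  assumes S: "S \<in> sets borel"
  obtains g :: "nat \<Rightarrow> 'a \<Rightarrow> real"
  where "\<And>n. continuous_on UNIV (g n)" "\<And>n x. \<bar>g n x\<bar> \<le> 1"
    "\<And>(M :: 'z measure) K. (\<And>z. z \<in> space M \<Longrightarrow> prob_space (K z)) \<Longrightarrow>
      (\<And>z. z \<in> space M \<Longrightarrow> sets (K z) = sets (restrict_space borel S)) \<Longrightarrow>
      (\<And>n. (\<lambda>z. \<integral>y. g n y \<partial>K z) \<in> borel_measurable M) \<Longrightarrow>
      K \<in> measurable M (prob_algebra (restrict_space borel S))"
proof -
  obtain G :: "'a set set" and g :: "nat \<Rightarrow> 'a \<Rightarrow> real"
    where G: "Int_stable G" "sets borel = sigma_sets UNIV G"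
      and g: "\<And>n. continuous_on UNIV (g n)" "\<And>n x. \<bar>g n x\<bar> \<le> 1"
        "\<And>U. U \<in> G \<Longrightarrow> \<exists>i. \<forall>x. (\<lambda>k. g (i k) x) \<longlonglongrightarrow> indicator U x"
    by (rule countable_continuous_approx_generator_borel) blast
  show thesis
  proof (rule that[OF g(1,2)])
    fix M :: "'z measure" and K
    assume K: "\<And>z. z \<in> space M \<Longrightarrow> prob_space (K z)"
      "\<And>z. z \<in> space M \<Longrightarrow> sets (K z) = sets (restrict_space borel S)"
      and integral: "\<And>n. (\<lambda>z. \<integral>y. g n y \<partial>K z) \<in> borel_measurable M"
    show "K \<in> measurable M (prob_algebra (restrict_space borel S))"
    proof (rule measurable_prob_algebra_integral_generated[OF _ Int_stable_Int_image[OF G(1), of S] _ K])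
      show "sets (restrict_space borel S) = sigma_sets S ((\<inter>) S ` G)"
        unfolding sets_restrict_space G(2) using S G(2) by (intro sigma_sets_Int) auto
      fix A assume "A \<in> (\<inter>) S ` G"
      then obtain U where U: "U \<in> G" "A = S \<inter> U" by auto
      obtain i where i: "\<And>x. (\<lambda>k. g (i k) x) \<longlonglongrightarrow> indicator U x" using g(3)[OF U(1)] by blast
      have "g (i k) \<in> borel_measurable (restrict_space borel S)" for k
        by (intro measurable_restrict_space1 borel_measurable_continuous_onI g(1))
      moreover have "(\<lambda>k. g (i k) x) \<longlonglongrightarrow> indicator A x" if "x \<in> S" for x
        using i[of x] that U(2) by (simp add: indicator_def)
      ultimately show "\<exists>h :: nat \<Rightarrow> 'a \<Rightarrow> real. (\<forall>k. h k \<in> borel_measurable (restrict_space borel S)) \<and>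
          (\<forall>k x. \<bar>h k x\<bar> \<le> 1) \<and> (\<forall>x\<in>space (restrict_space borel S). (\<lambda>k. h k x) \<longlonglongrightarrow> indicator A x) \<and>
          (\<forall>k. (\<lambda>z. \<integral>y. h k y \<partial>K z) \<in> borel_measurable M)"
        using g(2) integral by (intro exI[of _ "\<lambda>k. g (i k)"]) (simp add: space_restrict_space)
    qed auto
  qed
qed

text \<open>The library's \<open>integral_bind\<close> requires a bounded integrand.\<close>
lemma has_bochner_integral_bind_nonneg:
  fixes f :: "'b \<Rightarrow> real"
  assumes N: "N \<in> measurable M (subprob_algebra B)" and f: "f \<in> borel_measurable B" "\<And>y. 0 \<le> f y"
    and int: "integrable (M \<bind> N) f" "\<And>x. x \<in> space M \<Longrightarrow> integrable (N x) f"
  shows "has_bochner_integral M (\<lambda>x. \<integral>y. f y \<partial>N x) (\<integral>y. f y \<partial>(M \<bind> N))"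
proof (rule has_bochner_integral_nn_integral)
  show "(\<lambda>x. \<integral>y. f y \<partial>N x) \<in> borel_measurable M"
    by (rule measurable_compose[OF N integral_measurable_subprob_algebra[OF f(1)]])
  have "(\<integral>\<^sup>+x. ennreal (\<integral>y. f y \<partial>N x) \<partial>M) = (\<integral>\<^sup>+x. \<integral>\<^sup>+y. ennreal (f y) \<partial>N x \<partial>M)"
    using int(2) f(2) by (intro nn_integral_cong nn_integral_eq_integral[symmetric] AE_I2)
  also have "\<dots> = (\<integral>\<^sup>+y. ennreal (f y) \<partial>(M \<bind> N))"
    using f(1) by (simp add: nn_integral_bind[OF _ N])
  also have "\<dots> = ennreal (\<integral>y. f y \<partial>(M \<bind> N))"
    using int(1) f(2) by (intro nn_integral_eq_integral AE_I2)
  finally show "(\<integral>\<^sup>+x. ennreal (\<integral>y. f y \<partial>N x) \<partial>M) = ennreal (\<integral>y. f y \<partial>(M \<bind> N))" .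
qed (use f(2) in simp_all)

lemma has_bochner_integral_bind:
  fixes f :: "'b \<Rightarrow> real"
  assumes N: "N \<in> measurable M (subprob_algebra B)" and f: "f \<in> borel_measurable B"
    and int: "integrable (M \<bind> N) f" "\<And>x. x \<in> space M \<Longrightarrow> integrable (N x) f"
  shows "has_bochner_integral M (\<lambda>x. \<integral>y. f y \<partial>N x) (\<integral>y. f y \<partial>(M \<bind> N))"
proof -
  let ?pos = "\<lambda>y. max 0 (f y)" and ?neg = "\<lambda>y. max 0 (- f y)"
  have parts: "(\<integral>y. f y \<partial>L) = (\<integral>y. ?pos y \<partial>L) - (\<integral>y. ?neg y \<partial>L)" if "integrable L f" for L :: "'b measure"
  proof -
    have "(\<integral>y. f y \<partial>L) = (\<integral>y. ?pos y - ?neg y \<partial>L)"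
      by (intro Bochner_Integration.integral_cong) (simp_all add: max_def)
    also have "\<dots> = (\<integral>y. ?pos y \<partial>L) - (\<integral>y. ?neg y \<partial>L)"
      using that by (intro Bochner_Integration.integral_diff integrable_max
        Bochner_Integration.integrable_minus integrable_zero)
    finally show ?thesis .
  qed
  have "has_bochner_integral M (\<lambda>x. (\<integral>y. ?pos y \<partial>N x) - (\<integral>y. ?neg y \<partial>N x))
      ((\<integral>y. ?pos y \<partial>(M \<bind> N)) - (\<integral>y. ?neg y \<partial>(M \<bind> N)))"
    by (intro has_bochner_integral_diff has_bochner_integral_bind_nonneg[OF N] integrable_max integrable_zero
        Bochner_Integration.integrable_minus borel_measurable_max borel_measurable_uminus
          borel_measurable_const f int max.cobounded1)
  also have "?this \<longleftrightarrow> ?thesis"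
    using parts int by (intro has_bochner_integral_cong) simp_all
  finally show ?thesis .
qed

lemma sums_integral_real:
  fixes f :: "nat \<Rightarrow> 'a \<Rightarrow> real"
  assumes int: "\<And>i. integrable M (f i)" and sm: "summable (\<lambda>i. \<integral>x. \<bar>f i x\<bar> \<partial>M)"
  shows "(\<lambda>i. integral\<^sup>L M (f i)) sums (\<integral>x. (\<Sum>i. f i x) \<partial>M)"
proof (rule sums_integral[OF int])
  have [measurable]: "f i \<in> borel_measurable M" for i using int by (rule borel_measurable_integrable)
  have "(\<integral>\<^sup>+x. (\<Sum>i. ennreal \<bar>f i x\<bar>) \<partial>M) = (\<Sum>i. \<integral>\<^sup>+x. ennreal \<bar>f i x\<bar> \<partial>M)"
    by (rule nn_integral_suminf) measurable
  also have "\<dots> = (\<Sum>i. ennreal (\<integral>x. \<bar>f i x\<bar> \<partial>M))"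
    using int by (intro suminf_cong nn_integral_eq_integral) auto
  also have "\<dots> \<noteq> \<infinity>"
    unfolding infinity_ennreal_def by (rule ennreal_suminf_neq_top[OF sm]) simp
  finally have "AE x in M. (\<Sum>i. ennreal \<bar>f i x\<bar>) \<noteq> \<infinity>"
    by (rule nn_integral_PInf_AE[rotated]) measurable
  then show "AE x in M. summable (\<lambda>i. norm (f i x))"
    by (rule eventually_mono) (simp add: summable_suminf_not_top)
  show "summable (\<lambda>i. \<integral>x. norm (f i x) \<partial>M)" using sm by simp
qed

section \<open>Functions of polynomial growth\<close>

abbreviation weight :: "nat \<Rightarrow> 'x::real_normed_vector \<Rightarrow> real" where
  "weight p \<equiv> \<lambda>x. 1 + norm x ^ p"

lemma weight_pos [simp]: "0 < weight p x"
  by (simp add: add_pos_nonneg)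

lemma CpI: "continuous_on Om g \<Longrightarrow> (\<And>x. x \<in> Om \<Longrightarrow> \<bar>g x\<bar> \<le> C * weight p x) \<Longrightarrow> g \<in> Cp p Om"
  by (auto simp: Cp_def)

lemma CpE:
  assumes "g \<in> Cp p Om"
  obtains C where "continuous_on Om g" "0 \<le> C" "\<And>x. x \<in> Om \<Longrightarrow> \<bar>g x\<bar> \<le> C * weight p x"
proof -
  obtain C where C: "continuous_on Om g" "\<And>x. x \<in> Om \<Longrightarrow> \<bar>g x\<bar> \<le> C * weight p x"
    using assms by (auto simp: Cp_def)
  have "\<bar>g x\<bar> \<le> \<bar>C\<bar> * weight p x" if "x \<in> Om" for x
    using C(2)[OF that] weight_pos[of x p] by (meson abs_ge_self mult_right_mono order_trans less_imp_le)
  then show thesis using that[of "\<bar>C\<bar>"] C(1) by auto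
qed

lemma Cp_const: "(\<lambda>_. c) \<in> Cp p Om"
  by (rule CpI[where C = "\<bar>c\<bar>"]) (simp_all add: distrib_left)

lemma weight_Cp: "weight p \<in> Cp p Om"
  by (rule CpI[where C = 1]) (auto intro!: continuous_intros)

lemma Cp_add:
  assumes "f \<in> Cp p Om" "g \<in> Cp p Om"
  shows "(\<lambda>x. f x + g x) \<in> Cp p Om"
proof -
  obtain C where C: "continuous_on Om f" "\<And>x. x \<in> Om \<Longrightarrow> \<bar>f x\<bar> \<le> C * weight p x"
    using CpE[OF assms(1)] by metis
  obtain D where D: "continuous_on Om g" "\<And>x. x \<in> Om \<Longrightarrow> \<bar>g x\<bar> \<le> D * weight p x"
    using CpE[OF assms(2)] by metis
  show ?thesis
  proof (rule CpI)
    show "continuous_on Om (\<lambda>x. f x + g x)" by (intro continuous_intros C D)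
    show "\<bar>f x + g x\<bar> \<le> (C + D) * weight p x" if "x \<in> Om" for x
      using C(2)[OF that] D(2)[OF that] unfolding distrib_right[of C] by linarith
  qed
qed

lemma Cp_cmult:
  assumes "f \<in> Cp p Om"
  shows "(\<lambda>x. c * f x) \<in> Cp p Om"
proof -
  obtain C where C: "continuous_on Om f" "\<And>x. x \<in> Om \<Longrightarrow> \<bar>f x\<bar> \<le> C * weight p x"
    using CpE[OF assms] by metis
  show ?thesis
  proof (rule CpI)
    show "continuous_on Om (\<lambda>x. c * f x)" by (intro continuous_intros C)
    show "\<bar>c * f x\<bar> \<le> \<bar>c\<bar> * C * weight p x" if "x \<in> Om" for x
      using mult_left_mono[OF C(2)[OF that], of "\<bar>c\<bar>"] by (simp add: abs_mult mult.assoc)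
  qed
qed

lemma Cp_diff: "f \<in> Cp p Om \<Longrightarrow> g \<in> Cp p Om \<Longrightarrow> (\<lambda>x. f x - g x) \<in> Cp p Om"
  using Cp_add[OF _ Cp_cmult, of f p Om g "-1"] by simp

lemma Cp_bounded:
  assumes "continuous_on Om g" "\<And>x. \<bar>g x\<bar> \<le> C"
  shows "g \<in> Cp p Om"
proof (rule CpI[OF assms(1)])
  have "0 \<le> C" using assms(2) abs_ge_zero order_trans by blast
  then show "\<bar>g x\<bar> \<le> C * weight p x" for x
    using assms(2)[of x] mult_left_mono[of 1 "weight p x" C] by simp
qed

lemma Cp_borel_measurable: "g \<in> Cp p Om \<Longrightarrow> g \<in> borel_measurable (locsp Om)"
  by (auto simp: Cp_def intro: borel_measurable_continuous_on_restrict)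

lemma borel_measurable_ennreal_weight: "(\<lambda>x. ennreal (weight p x)) \<in> borel_measurable (locsp Om)"
  by (intro measurable_compose[OF Cp_borel_measurable[OF weight_Cp] measurable_ennreal])

lemma cpnorm_le_iff:
  assumes "Om \<noteq> {}" "g \<in> Cp p Om"
  shows "cpnorm p Om g \<le> C \<longleftrightarrow> (\<forall>x\<in>Om. \<bar>g x\<bar> \<le> C * weight p x)"
proof -
  obtain D where "\<And>x. x \<in> Om \<Longrightarrow> \<bar>g x\<bar> \<le> D * weight p x" using CpE[OF assms(2)] by metis
  then have "bdd_above ((\<lambda>x. \<bar>g x\<bar> / weight p x) ` Om)"
    by (intro bdd_aboveI2[where M = D]) (simp add: divide_le_eq)
  then show ?thesis
    unfolding cpnorm_def using assms(1) by (simp add: cSUP_le_iff divide_le_eq)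
qed

lemma abs_le_cpnorm: "g \<in> Cp p Om \<Longrightarrow> x \<in> Om \<Longrightarrow> \<bar>g x\<bar> \<le> cpnorm p Om g * weight p x"
  using cpnorm_le_iff[of Om g p "cpnorm p Om g"] by auto

lemma cpnorm_nonneg:
  assumes "Om \<noteq> {}" "g \<in> Cp p Om"
  shows "0 \<le> cpnorm p Om g"
proof -
  obtain x where "x \<in> Om" using assms(1) by auto
  from abs_le_cpnorm[OF assms(2) this] have "0 \<le> cpnorm p Om g * weight p x" by linarith
  then show ?thesis using weight_pos[of x p] by (simp add: zero_le_mult_iff)
qed

text \<open>Dividing by the weight maps \<open>Cp p Om\<close> isometrically onto the complete metric space of bounded
  continuous functions on \<open>Om\<close>.\<close>
definition Cp_scale :: "nat \<Rightarrow> 'x::real_normed_vector set \<Rightarrow> ('x \<Rightarrow> real) \<Rightarrow> 'x \<Rightarrow> real" where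
  "Cp_scale p Om v = restrict (\<lambda>x. v x / weight p x) Om"

lemma Cp_scale_mspace:
  assumes "v \<in> Cp p Om"
  shows "Cp_scale p Om v \<in> mspace (cfunspace (top_of_set Om) euclidean_metric)"
proof -
  obtain C where C: "continuous_on Om v" "\<And>x. x \<in> Om \<Longrightarrow> \<bar>v x\<bar> \<le> C * weight p x"
    using CpE[OF assms] by metis
  have "continuous_on Om (\<lambda>x. v x / weight p x)"
    by (intro continuous_intros C ballI less_imp_neq[OF weight_pos, symmetric])
  then have "continuous_on Om (Cp_scale p Om v)"
    by (rule continuous_on_eq) (simp add: Cp_scale_def)
  moreover have "bounded (Cp_scale p Om v ` Om)"
    using C(2) unfolding bounded_iff
    by (intro exI[of _ C]) (auto simp: Cp_scale_def abs_divide divide_le_eq)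
  ultimately show ?thesis by (simp add: Cp_scale_def)
qed

lemma mult_weight_Cp:
  assumes "b \<in> mspace (cfunspace (top_of_set Om) euclidean_metric)"
  shows "(\<lambda>x. b x * weight p x) \<in> Cp p Om"
proof -
  have b: "continuous_on Om b" "bounded (b ` Om)" using assms by simp_all
  then obtain C where "\<And>x. x \<in> Om \<Longrightarrow> \<bar>b x\<bar> \<le> C" by (auto simp: bounded_iff)
  then show ?thesis
    using b(1) by (intro CpI[where C = C] continuous_intros) (auto simp: abs_mult intro: mult_right_mono)
qed

lemma Cp_scale_mult_weight:
  assumes "b \<in> mspace (cfunspace (top_of_set Om) euclidean_metric)"
  shows "Cp_scale p Om (\<lambda>x. b x * weight p x) = b"
  using assms less_imp_neq[OF weight_pos, of _ p] by (auto simp: Cp_scale_def fun_eq_iff extensional_def)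

lemma mdist_Cp_scale:
  assumes "Om \<noteq> {}" "v \<in> Cp p Om" "u \<in> Cp p Om"
  shows "mdist (cfunspace (top_of_set Om) euclidean_metric) (Cp_scale p Om v) (Cp_scale p Om u)
    = cpnorm p Om (\<lambda>x. v x - u x)" (is "?d = ?c")
proof -
  have "dist (Cp_scale p Om v x) (Cp_scale p Om u x) \<le> a \<longleftrightarrow> \<bar>v x - u x\<bar> \<le> a * weight p x" if "x \<in> Om" for x a
    using that by (simp add: Cp_scale_def dist_real_def abs_divide divide_le_eq flip: diff_divide_distrib)
  then have "?d \<le> a \<longleftrightarrow> ?c \<le> a" for a
    using cfunspace_mdist_le[OF Cp_scale_mspace[OF assms(2)] Cp_scale_mspace[OF assms(3)]] assms(1)
      cpnorm_le_iff[OF assms(1) Cp_diff[OF assms(2,3)]] by simp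
  then show ?thesis by (meson antisym order_refl)
qed

locale Cp_contraction =
  fixes p :: nat and Om :: "'x::euclidean_space set" and T :: "('x \<Rightarrow> real) \<Rightarrow> 'x \<Rightarrow> real" and q :: real
  assumes nonempty: "Om \<noteq> {}" and factor: "0 \<le> q" "q < 1"
    and closed: "v \<in> Cp p Om \<Longrightarrow> T v \<in> Cp p Om"
    and contraction: "v \<in> Cp p Om \<Longrightarrow> u \<in> Cp p Om \<Longrightarrow>
      cpnorm p Om (\<lambda>x. T v x - T u x) \<le> q * cpnorm p Om (\<lambda>x. v x - u x)"
begin

lemma fixed_point_exists:
  obtains v where "v \<in> Cp p Om" "\<And>x. x \<in> Om \<Longrightarrow> T v x = v x"
proof -
  let ?B = "cfunspace (top_of_set Om) (euclidean_metric :: real metric)"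
  let ?mult = "\<lambda>b x. b x * weight p x"
  let ?T = "\<lambda>b. Cp_scale p Om (T (?mult b))"
  interpret B: Metric_space "mspace ?B" "mdist ?B" by (rule Metric_space_mspace_mdist)
  have T: "T (?mult b) \<in> Cp p Om" if "b \<in> mspace ?B" for b
    using that by (intro closed mult_weight_Cp)
  have "Metric_space.mcomplete (UNIV :: real set) dist"
    by (simp add: mcomplete_iff_complete complete_UNIV)
  from Met_TC.mcomplete_cfunspace[OF this] have "B.mcomplete"
    by (simp only: mcomplete_of_def Met_TC.Self_def euclidean_metric_def)
  moreover have "mspace ?B \<noteq> {}"
    using Cp_scale_mspace[OF Cp_const] by blast
  moreover have "?T \<in> mspace ?B \<rightarrow> mspace ?B"
    using Cp_scale_mspace T by blast
  moreover have "mdist ?B (?T b) (?T c) \<le> q * mdist ?B b c" if "b \<in> mspace ?B" "c \<in> mspace ?B" for b c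
  proof -
    have "mdist ?B (?T b) (?T c) = cpnorm p Om (\<lambda>x. T (?mult b) x - T (?mult c) x)"
      by (intro mdist_Cp_scale nonempty T that)
    also have "\<dots> \<le> q * cpnorm p Om (\<lambda>x. ?mult b x - ?mult c x)"
      by (intro contraction mult_weight_Cp that)
    also have "cpnorm p Om (\<lambda>x. ?mult b x - ?mult c x) = mdist ?B b c"
      using mdist_Cp_scale[OF nonempty that[THEN mult_weight_Cp]] unfolding that[THEN Cp_scale_mult_weight] ..
    finally show ?thesis .
  qed
  ultimately obtain b where b: "b \<in> mspace ?B" "?T b = b"
    using B.Banach_fixedpoint_thm[OF _ _ _ factor(2), of ?T] by blast
  have "T (?mult b) x = ?mult b x" if "x \<in> Om" for x
    using fun_cong[OF b(2), of x] that less_imp_neq[OF weight_pos, of x p] by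
      (simp add: Cp_scale_def divide_eq_eq)
  with mult_weight_Cp[OF b(1)] show thesis by (rule that)
qed

lemma iterate_Cp: "v \<in> Cp p Om \<Longrightarrow> (T ^^ n) v \<in> Cp p Om"
  by (induction n) (auto intro: closed)

lemma cpnorm_iterate_diff_le:
  assumes v: "v \<in> Cp p Om" "\<And>x. x \<in> Om \<Longrightarrow> T v x = v x" and u: "u \<in> Cp p Om"
  shows "cpnorm p Om (\<lambda>x. (T ^^ n) u x - v x) \<le> q ^ n * cpnorm p Om (\<lambda>x. u x - v x)"
proof (induction n)
  case (Suc n)
  have "cpnorm p Om (\<lambda>x. (T ^^ Suc n) u x - v x) = cpnorm p Om (\<lambda>x. T ((T ^^ n) u) x - T v x)"
    unfolding cpnorm_def using v(2) by (intro SUP_cong) auto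
  also have "\<dots> \<le> q * cpnorm p Om (\<lambda>x. (T ^^ n) u x - v x)"
    by (intro contraction iterate_Cp u v)
  also have "\<dots> \<le> q * (q ^ n * cpnorm p Om (\<lambda>x. u x - v x))"
    by (intro mult_left_mono Suc factor)
  finally show ?case by (simp add: mult.assoc)
qed simp

lemma iterates_tendsto_fixed_point:
  assumes v: "v \<in> Cp p Om" "\<And>x. x \<in> Om \<Longrightarrow> T v x = v x" and u: "u \<in> Cp p Om"
  shows "(\<lambda>n. cpnorm p Om (\<lambda>x. (T ^^ n) u x - v x)) \<longlonglongrightarrow> 0"
proof (rule Lim_null_comparison[OF always_eventually])
  show "(\<lambda>n. q ^ n * cpnorm p Om (\<lambda>x. u x - v x)) \<longlonglongrightarrow> 0"
    using factor by (intro tendsto_mult_left_zero LIMSEQ_power_zero) auto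
  show "\<forall>n. norm (cpnorm p Om (\<lambda>x. (T ^^ n) u x - v x)) \<le> q ^ n * cpnorm p Om (\<lambda>x. u x - v x)"
    using cpnorm_iterate_diff_le[OF assms] cpnorm_nonneg[OF nonempty Cp_diff[OF iterate_Cp[OF u] v(1)]] by simp
qed

lemma fixed_point_unique:
  assumes v: "v \<in> Cp p Om" "\<And>x. x \<in> Om \<Longrightarrow> T v x = v x"
    and u: "u \<in> Cp p Om" "\<And>x. x \<in> Om \<Longrightarrow> T u x = u x" and x: "x \<in> Om"
  shows "u x = v x"
proof -
  let ?c = "cpnorm p Om (\<lambda>x. u x - v x)"
  have "?c = cpnorm p Om (\<lambda>x. T u x - T v x)"
    unfolding cpnorm_def using u(2) v(2) by (intro SUP_cong) auto
  also have "\<dots> \<le> q * ?c" by (rule contraction[OF u(1) v(1)])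
  finally have "?c * (1 - q) \<le> 0" by (simp add: algebra_simps)
  then have "?c \<le> 0" using factor(2) by (simp add: mult_le_0_iff)
  then have "\<bar>u x - v x\<bar> \<le> 0 * weight p x"
    using cpnorm_le_iff[OF nonempty Cp_diff[OF u(1) v(1)]] x by blast
  then show ?thesis by simp
qed

theorem fixed_point_theorem:
  "\<exists>v\<in>Cp p Om. (\<forall>x\<in>Om. T v x = v x) \<and>
    (\<forall>u\<in>Cp p Om. (\<forall>x\<in>Om. T u x = u x) \<longrightarrow> (\<forall>x\<in>Om. u x = v x)) \<and>
    (\<forall>u\<in>Cp p Om. (\<lambda>n. cpnorm p Om (\<lambda>x. (T ^^ n) u x - v x)) \<longlonglongrightarrow> 0)"
proof -
  obtain v where v: "v \<in> Cp p Om" "\<And>x. x \<in> Om \<Longrightarrow> T v x = v x"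
    using fixed_point_exists by blast
  then show ?thesis
    using fixed_point_unique[OF v] iterates_tendsto_fixed_point[OF v] by blast
qed

end

section \<open>The topology \<open>tau p\<close> of measures with finite \<open>p\<close>-th moment\<close>

lemma M1pD:
  assumes "Q \<in> M1p p Om"
  shows "sets Q = sets (locsp Om)" "space Q = Om" "prob_space Q" "integrable Q (weight p)"
proof -
  show sets: "sets Q = sets (locsp Om)" and prob: "prob_space Q"
    using assms by (auto simp: M1p_def M1_def)
  show "space Q = Om"
    using sets_eq_imp_space_eq[OF sets] by (simp add: space_restrict_space)
  interpret prob_space Q by (rule prob)
  show "integrable Q (weight p)" using assms by (simp add: M1p_def)
qed

lemma M1pI:
  assumes Q: "sets Q = sets (locsp Om)" "prob_space Q"
    and moment: "(\<integral>\<^sup>+y. ennreal (weight p y) \<partial>Q) \<le> ennreal C" and C: "0 \<le> C"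
  shows "Q \<in> M1p p Om" "integral\<^sup>L Q (weight p) \<le> C"
proof -
  interpret prob_space Q by (rule Q(2))
  have "weight p \<in> borel_measurable Q"
    using Cp_borel_measurable[OF weight_Cp] measurable_cong_sets[OF Q(1) refl] by blast
  then have "integrable Q (weight p)"
    using le_less_trans[OF moment ennreal_less_top]
    by (intro integrableI_nonneg) (auto simp: less_imp_le)
  then have "integrable Q (\<lambda>y. weight p y - 1)"
    by (intro Bochner_Integration.integrable_diff integrable_const)
  then show "Q \<in> M1p p Om" using Q by (simp add: M1p_def M1_def)
  show "integral\<^sup>L Q (weight p) \<le> C" by (rule integral_real_bounded[OF C moment])
qed

lemma integrable_Cp:
  assumes "g \<in> Cp p Om" "Q \<in> M1p p Om"
  shows "integrable Q g"
proof -
  obtain C where C: "\<And>x. x \<in> Om \<Longrightarrow> \<bar>g x\<bar> \<le> C * weight p x" using CpE[OF assms(1)] by metis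
  show ?thesis
  proof (rule Bochner_Integration.integrable_bound)
    show "integrable Q (\<lambda>x. C * weight p x)" using M1pD(4)[OF assms(2)] by (rule integrable_mult_right)
    show "g \<in> borel_measurable Q"
      using Cp_borel_measurable[OF assms(1)] measurable_cong_sets[OF M1pD(1)[OF assms(2)] refl] by blast
    show "AE x in Q. norm (g x) \<le> norm (C * weight p x)"
      using C M1pD(2)[OF assms(2)] by (intro AE_I2) (auto intro: order_trans[OF _ abs_ge_self])
  qed
qed

lemma abs_integral_le_weight:
  assumes Q: "Q \<in> M1p p Om" and g: "g \<in> Cp p Om" "\<And>y. y \<in> Om \<Longrightarrow> \<bar>g y\<bar> \<le> B + C * weight p y"
  shows "\<bar>integral\<^sup>L Q g\<bar> \<le> B + C * integral\<^sup>L Q (weight p)"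
proof -
  interpret prob_space Q by (rule M1pD(3)[OF Q])
  have weight: "integrable Q (\<lambda>y. C * weight p y)"
    by (rule integrable_mult_right[OF M1pD(4)[OF Q]])
  have "\<bar>integral\<^sup>L Q g\<bar> \<le> (\<integral>y. \<bar>g y\<bar> \<partial>Q)" by (rule integral_abs_bound)
  also have "\<dots> \<le> (\<integral>y. B + C * weight p y \<partial>Q)"
    using g(2) M1pD(2)[OF Q]
    by (intro integral_mono integrable_abs integrable_Cp[OF g(1) Q]
      Bochner_Integration.integrable_add integrable_const weight) auto
  also have "\<dots> = B + C * integral\<^sup>L Q (weight p)"
    by (simp only: Bochner_Integration.integral_add[OF integrable_const weight]
      integral_mult_right_zero lebesgue_integral_const prob_space scaleR_one)
  finally show ?thesis .
qed

lemma abs_integral_diff_le_weight: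
  assumes "Q \<in> M1p p Om" "h \<in> Cp p Om" "g \<in> Cp p Om" "\<And>y. y \<in> Om \<Longrightarrow> \<bar>h y - g y\<bar> \<le> C * weight p y"
  shows "\<bar>integral\<^sup>L Q h - integral\<^sup>L Q g\<bar> \<le> C * integral\<^sup>L Q (weight p)"
  using abs_integral_le_weight[OF assms(1) Cp_diff[OF assms(2,3)], of 0 C] assms(4)
    integrable_Cp[OF assms(2,1)] integrable_Cp[OF assms(3,1)] by simp

lemma topspace_tau: "topspace (tau p Om) = M1p p Om"
proof -
  have "M1p p Om \<subseteq> \<Union>{{M \<in> M1p p Om. integral\<^sup>L M g \<in> U} | g U. g \<in> Cp p Om \<and> open U}"
    using Cp_const[of 0] by (intro Union_upper) (auto intro!: exI[of _ UNIV])
  then show ?thesis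
    unfolding tau_def topology_generated_by_topspace by auto
qed

lemma continuous_map_integral_tau:
  assumes "g \<in> Cp p Om"
  shows "continuous_map (tau p Om) euclideanreal (\<lambda>Q. integral\<^sup>L Q g)"
  unfolding continuous_map topspace_tau
proof (intro conjI allI impI)
  fix U :: "real set" assume "openin euclideanreal U"
  then show "openin (tau p Om) {Q \<in> M1p p Om. integral\<^sup>L Q g \<in> U}"
    unfolding tau_def using assms by (intro topology_generated_by_Basis) auto
qed simp

lemma continuous_map_integral_tau_snd:
  assumes "g \<in> Cp p Om"
  shows "continuous_map (prod_topology X (tau p Om)) euclideanreal (\<lambda>(z, Q). integral\<^sup>L Q g)"
  using continuous_map_compose[OF continuous_map_snd continuous_map_integral_tau[OF assms]]
  by (simp add: comp_def case_prod_beta')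

lemma continuous_map_param_integral_tau:
  fixes Z :: "'z::topological_space set" and h :: "'z \<Rightarrow> 'x::euclidean_space \<Rightarrow> real"
  assumes h: "\<And>z. z \<in> Z \<Longrightarrow> h z \<in> Cp p Om"
    and unif: "\<And>z0 e. z0 \<in> Z \<Longrightarrow> 0 < e \<Longrightarrow>
      \<exists>U. openin (top_of_set Z) U \<and> z0 \<in> U \<and> (\<forall>z\<in>U. \<forall>y\<in>Om. \<bar>h z y - h z0 y\<bar> \<le> e * weight p y)"
  shows "continuous_map (prod_topology (top_of_set Z) (tau p Om)) euclideanreal (\<lambda>(z, Q). integral\<^sup>L Q (h z))"
  unfolding mtopology_is_euclidean[symmetric] Met_TC.continuous_map_to_metric
proof (clarify, goal_cases)
  case (1 z0 Q0 e)
  then have z0: "z0 \<in> Z" and Q0: "Q0 \<in> M1p p Om" and e: "0 < e" by (simp_all add: topspace_tau)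
  define W where "W = integral\<^sup>L Q0 (weight p) + 1"
  have W: "0 < W"
    unfolding W_def by (intro add_nonneg_pos integral_nonneg_AE AE_I2 less_imp_le weight_pos zero_less_one)
  obtain U where U: "openin (top_of_set Z) U" "z0 \<in> U"
      "\<And>z y. z \<in> U \<Longrightarrow> y \<in> Om \<Longrightarrow> \<bar>h z y - h z0 y\<bar> \<le> e / (2 * W) * weight p y"
    using unif[OF z0, of "e / (2 * W)"] e W by auto
  define V where "V = {Q \<in> topspace (tau p Om). integral\<^sup>L Q (weight p) \<in> {..<W}} \<inter>
    {Q \<in> topspace (tau p Om). integral\<^sup>L Q (h z0) \<in> ball (integral\<^sup>L Q0 (h z0)) (e / 2)}"
  have "openin (tau p Om) V"
    unfolding V_def
    by (intro openin_Int openin_continuous_map_preimage[OF continuous_map_integral_tau] weight_Cp h z0) simp_all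
  moreover have "Q0 \<in> V" using Q0 e by (simp add: V_def W_def topspace_tau)
  moreover have "dist (integral\<^sup>L Q0 (h z0)) (integral\<^sup>L Q (h z)) < e" if z: "z \<in> U" and Q: "Q \<in> V" for z Q
  proof -
    have QM: "Q \<in> M1p p Om" and moment: "integral\<^sup>L Q (weight p) < W"
      and near: "\<bar>integral\<^sup>L Q0 (h z0) - integral\<^sup>L Q (h z0)\<bar> < e / 2"
      using Q by (auto simp: V_def topspace_tau dist_real_def)
    have hz: "h z \<in> Cp p Om" using openin_imp_subset[OF U(1)] z by (intro h) auto
    have "\<bar>integral\<^sup>L Q (h z) - integral\<^sup>L Q (h z0)\<bar> \<le> e / (2 * W) * integral\<^sup>L Q (weight p)"
      by (intro abs_integral_diff_le_weight[OF QM hz h[OF z0]] U(3) z)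
    also have "\<dots> \<le> e / (2 * W) * W"
      using moment W e by (intro mult_left_mono) simp_all
    also have "\<dots> = e / 2" using W by simp
    finally show ?thesis using near unfolding dist_real_def by linarith
  qed
  ultimately show ?case
    using U(1,2) by (intro exI[of _ "U \<times> V"]) (auto simp: openin_prod_Times_iff)
qed

section \<open>Path measures\<close>

locale kernel_path =
  fixes Om :: "'x::euclidean_space set" and x :: 'x and K :: "nat \<Rightarrow> 'x \<Rightarrow> 'x measure"
  assumes start: "x \<in> Om" and K_measurable: "\<And>t. K t \<in> measurable (locsp Om) (prob_algebra (locsp Om))"
begin

abbreviation "S \<equiv> locsp Om"
abbreviation "path_space I \<equiv> PiM I (\<lambda>_::nat. S)"
abbreviation "transition t u \<equiv> distr (K t u) (S \<Otimes>\<^sub>M S) (Pair u)"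

lemma space_S [simp]: "space S = Om" by (simp add: space_restrict_space)

lemma K_subprob [measurable]: "K t \<in> measurable S (subprob_algebra S)"
  using K_measurable by (rule measurable_prob_algebraD)

lemma K_prob: "y \<in> Om \<Longrightarrow> prob_space (K t y)"
  and sets_K: "y \<in> Om \<Longrightarrow> sets (K t y) = sets S"
  using measurable_space[OF K_measurable, of y] by (simp_all add: space_prob_algebra)

definition IT_kernel :: "nat \<Rightarrow> (nat \<Rightarrow> 'x) \<Rightarrow> 'x measure" where
  "IT_kernel i \<omega> = (case i of 0 \<Rightarrow> return S x | Suc j \<Rightarrow> K j (\<omega> j))"

sublocale IT: Ionescu_Tulcea IT_kernel "\<lambda>_. S"
proof (rule Ionescu_Tulcea.intro)
  fix i
  show "IT_kernel i \<in> measurable (path_space {0..<i}) (subprob_algebra S)"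
  proof (cases i)
    case 0
    have "return S x \<in> space (subprob_algebra S)"
      using start by (simp add: space_subprob_algebra prob_space_imp_subprob_space prob_space_return)
    then show ?thesis by (simp add: IT_kernel_def[abs_def] 0)
  next
    case (Suc j)
    have "(\<lambda>\<omega>. K j (\<omega> j)) \<in> measurable (path_space {0..<Suc j}) (subprob_algebra S)"
      by (intro measurable_compose[OF _ K_subprob] measurable_component_singleton) simp
    then show ?thesis by (simp add: IT_kernel_def[abs_def] Suc)
  qed
next
  fix i \<omega> assume \<omega>: "\<omega> \<in> space (path_space {0..<i})"
  show "prob_space (IT_kernel i \<omega>)"
  proof (cases i)
    case 0
    then show ?thesis using prob_space_return[of x S] start by (simp add: IT_kernel_def)
  next
    case (Suc j)
    with \<omega> have "\<omega> j \<in> Om" by (auto simp: space_PiM PiE_iff)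
    then show ?thesis using K_prob[of "\<omega> j" j] Suc by (simp add: IT_kernel_def)
  qed
qed

lemma undefined_in_empty_path_space: "(\<lambda>_. undefined) \<in> space (path_space {0..<0})"
  by (simp add: space_PiM)

lemma IT_C_eq_fdd: "IT.C 0 (Suc n) (\<lambda>_. undefined) = fdd Om x K n"
proof (induction n)
  case 0
  have "IT.C 0 (Suc 0) (\<lambda>_. undefined) = IT.eP 0 (\<lambda>_. undefined)"
    using bind_return[OF IT.measurable_eP[of 0] undefined_in_empty_path_space] by simp
  also have "\<dots> = fdd Om x K 0"
    by (simp add: IT.eP_def IT_kernel_def) (rule distr_cong, auto simp: fun_eq_iff)
  finally show ?case .
next
  case (Suc n)
  have "IT.C 0 (Suc (Suc n)) (\<lambda>_. undefined) = IT.C 0 (Suc n) (\<lambda>_. undefined) \<bind> IT.eP (Suc n)"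
    by simp
  also have "\<dots> = fdd Om x K (Suc n)"
    unfolding fdd.simps
  proof (rule bind_cong[OF Suc.IH])
    fix \<omega> assume "\<omega> \<in> space (IT.C 0 (Suc n) (\<lambda>_. undefined))"
    then have "\<omega> \<in> extensional {..n}"
      unfolding IT.space_C[OF undefined_in_empty_path_space]
      by (simp add: space_PiM PiE_iff atLeast0LessThan lessThan_Suc_atMost)
    then have "fun_upd \<omega> (Suc n) = (\<lambda>y. \<lambda>i\<in>{..Suc n}. if i = Suc n then y else \<omega> i)"
      by (auto simp: fun_eq_iff extensional_def)
    then show "IT.eP (Suc n) \<omega> = distr (K n (\<omega> n)) (path_space {..Suc n})
        (\<lambda>y. \<lambda>i\<in>{..Suc n}. if i = Suc n then y else \<omega> i)"
      by (simp add: IT.eP_def IT_kernel_def atLeast0LessThan lessThan_Suc_atMost)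
  qed
  finally show ?case .
qed

lemma sets_fdd [measurable_cong]: "sets (fdd Om x K n) = sets (path_space {..n})"
  using IT.sets_C[OF undefined_in_empty_path_space, of "Suc n"] unfolding IT_C_eq_fdd
  by (simp add: atLeast0LessThan lessThan_Suc_atMost)

lemma space_fdd: "space (fdd Om x K n) = space (path_space {..n})"
  by (rule sets_eq_imp_space_eq[OF sets_fdd])

lemma prob_space_fdd: "prob_space (fdd Om x K n)"
  using IT.prob_space_C[OF undefined_in_empty_path_space, of "Suc n"] unfolding IT_C_eq_fdd .

lemma distr_lim_eq_fdd: "distr IT.PF.lim (path_space {..n}) (\<lambda>\<omega>. restrict \<omega> {..n}) = fdd Om x K n"
proof -
  have "IT.up_to {..n} = Suc n"
    using IT.up_to_less[of "{..n}" n] IT.up_to_iff[of "{..n}" "Suc n"]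
      by (simp add: less_Suc_eq_le le_antisym Suc_leI)
  then have "IT.CI {..n} = distr (fdd Om x K n) (path_space {..n}) (\<lambda>\<omega>. restrict \<omega> {..n})"
    by (simp only: IT.CI_def IT_C_eq_fdd)
  also have "\<dots> = distr (fdd Om x K n) (fdd Om x K n) (\<lambda>\<omega>. \<omega>)"
    by (intro distr_cong refl sets_fdd[symmetric]) (auto simp: space_fdd space_PiM PiE_iff extensional_restrict)
  finally show ?thesis by (simp add: IT.distr_lim distr_id)
qed

lemma prob_space_lim: "prob_space IT.PF.lim"
proof (rule prob_space_distrD)
  show "prob_space (distr IT.PF.lim (path_space {..0}) (\<lambda>\<omega>. restrict \<omega> {..0}))"
    unfolding distr_lim_eq_fdd by (rule prob_space_fdd)
qed (simp add: measurable_cong_sets[OF IT.PF.sets_lim refl] measurable_restrict_subset)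

lemma measure_eqI_fdd:
  assumes M: "sets M = sets (path_space UNIV)" "prob_space M"
      "\<And>n. distr M (path_space {..n}) (\<lambda>\<omega>. restrict \<omega> {..n}) = fdd Om x K n"
    and N: "sets N = sets (path_space UNIV)"
      "\<And>n. distr N (path_space {..n}) (\<lambda>\<omega>. restrict \<omega> {..n}) = fdd Om x K n"
  shows "M = N"
proof (rule measure_eqI_PiM_infinite[OF M(1) N(1)])
  show "finite_measure M" using M(2) by (rule prob_space.finite_measure)
  fix B and J :: "nat set" assume J: "finite J" and B: "\<And>i. i \<in> J \<Longrightarrow> B i \<in> sets S"
  obtain n where n: "J \<subseteq> {..n}" using J finite_nat_iff_bounded_le by auto
  let ?X = "prod_emb {..n} (\<lambda>_. S) J (Pi\<^sub>E J B)"
  have X: "?X \<in> sets (path_space {..n})" using J B n by (intro sets_PiM_I) auto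
  have "emeasure L (prod_emb UNIV (\<lambda>_. S) J (Pi\<^sub>E J B)) = emeasure (fdd Om x K n) ?X"
    if "sets L = sets (path_space UNIV)" "distr L (path_space {..n}) (\<lambda>\<omega>. restrict \<omega> {..n}) = fdd Om x K n"
      for L
    using emeasure_distr_restrict[OF _ that(1) X] n by (simp add: that(2))
  then show "emeasure M (prod_emb UNIV (\<lambda>_. S) J (Pi\<^sub>E J B)) = emeasure N (prod_emb UNIV (\<lambda>_. S) J (Pi\<^sub>E J B))"
    using M N by simp
qed

lemma pathmeas_eq_lim: "pathmeas Om x K = IT.PF.lim"
  unfolding pathmeas_def
proof (rule the_equality)
  show "sets IT.PF.lim = sets (path_space UNIV) \<and> prob_space IT.PF.lim \<and>
      (\<forall>n. distr IT.PF.lim (path_space {..n}) (\<lambda>\<omega>. restrict \<omega> {..n}) = fdd Om x K n)"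
    using prob_space_lim distr_lim_eq_fdd by simp
next
  fix M assume "sets M = sets (path_space UNIV) \<and> prob_space M \<and>
      (\<forall>n. distr M (path_space {..n}) (\<lambda>\<omega>. restrict \<omega> {..n}) = fdd Om x K n)"
  then show "M = IT.PF.lim"
    by (elim conjE) (rule measure_eqI_fdd[OF _ _ _ IT.PF.sets_lim distr_lim_eq_fdd], blast+)
qed

abbreviation "P \<equiv> pathmeas Om x K"

lemma sets_P [measurable_cong]: "sets P = sets (path_space UNIV)"
  by (simp add: pathmeas_eq_lim)

lemma coord_in_Om: "\<omega> \<in> space P \<Longrightarrow> \<omega> t \<in> Om"
  using sets_eq_imp_space_eq[OF sets_P] by (simp add: space_PiM PiE_UNIV_domain Pi_iff)

lemma measurable_coord [measurable]: "(\<lambda>\<omega>. \<omega> t) \<in> measurable P S"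
  by measurable

sublocale path: prob_space P
  unfolding pathmeas_eq_lim by (rule prob_space_lim)

lemma distr_pathmeas_eq_distr_fdd:
  assumes f: "f \<in> measurable (path_space {..n}) N"
  shows "distr P N (\<lambda>\<omega>. f (restrict \<omega> {..n})) = distr (fdd Om x K n) N f"
proof -
  have "(\<lambda>\<omega>. restrict \<omega> {..n}) \<in> measurable P (path_space {..n})"
    unfolding measurable_cong_sets[OF sets_P refl] by (rule measurable_restrict_subset) simp
  from distr_distr[OF f this] show ?thesis
    by (simp add: comp_def distr_lim_eq_fdd pathmeas_eq_lim)
qed

definition law :: "nat \<Rightarrow> 'x measure" where
  "law t = distr P S (\<lambda>\<omega>. \<omega> t)"

lemma sets_law [measurable_cong]: "sets (law t) = sets S"
  by (simp add: law_def)

lemma space_law [simp]: "space (law t) = Om"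
  by (simp add: law_def)

lemma prob_space_law: "prob_space (law t)"
  unfolding law_def by (intro path.prob_space_distr measurable_coord)

lemma law_eq_distr_fdd: "law t = distr (fdd Om x K t) S (\<lambda>\<omega>. \<omega> t)"
proof -
  have "(\<lambda>\<omega>. \<omega> t) \<in> measurable (path_space {..t}) S"
    by (rule measurable_component_singleton) simp
  from distr_pathmeas_eq_distr_fdd[OF this] show ?thesis by (simp add: law_def)
qed

lemma law_0: "law 0 = return S x"
proof -
  have "(\<lambda>y. \<lambda>i\<in>{..0}. y) \<in> measurable (return S x) (path_space {..0})"
    by (intro measurable_restrict) simp
  moreover have "(\<lambda>\<omega>. \<omega> 0) \<in> measurable (path_space {..0}) S"
    by (rule measurable_component_singleton) simp
  ultimately have "law 0 = distr (return S x) S (\<lambda>y. y)"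
    unfolding law_eq_distr_fdd fdd.simps by (simp add: distr_distr comp_def)
  also have "\<dots> = return S x"
    by (intro distr_id2) simp
  finally show ?thesis .
qed

lemma measurable_transition:
  "transition t \<in> measurable S (subprob_algebra (S \<Otimes>\<^sub>M S))"
  by (rule measurable_distr2[OF _ K_subprob]) simp

lemma measurable_transition_law: "transition t \<in> measurable (law t) (subprob_algebra (S \<Otimes>\<^sub>M S))"
  using measurable_transition by (simp add: measurable_cong_sets[OF sets_law refl])

lemma measurable_path_extension:
  "(\<lambda>(\<omega>, y). \<lambda>i\<in>{..Suc t}. if i = Suc t then y else \<omega> i)
    \<in> measurable (path_space {..t} \<Otimes>\<^sub>M S) (path_space {..Suc t})"
  unfolding case_prod_beta'
proof (rule measurable_restrict)
  fix i assume "i \<in> {..Suc t}"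
  then show "(\<lambda>z. if i = Suc t then snd z else fst z i) \<in> measurable (path_space {..t} \<Otimes>\<^sub>M S) S"
    by (cases "i = Suc t")
       (auto intro!: measurable_compose[OF measurable_fst] measurable_component_singleton)
qed

lemma distr_pathmeas_transition:
  "distr P (S \<Otimes>\<^sub>M S) (\<lambda>\<omega>. (\<omega> t, \<omega> (Suc t))) = law t \<bind> transition t"
proof -
  let ?extend = "\<lambda>\<omega> y. \<lambda>i\<in>{..Suc t}. if i = Suc t then y else \<omega> i"
  let ?pair = "\<lambda>\<omega>. (\<omega> t, \<omega> (Suc t))"
  have pair: "?pair \<in> measurable (path_space {..Suc t}) (S \<Otimes>\<^sub>M S)"
    by (intro measurable_Pair measurable_component_singleton) auto
  have coord: "(\<lambda>\<omega>. \<omega> t) \<in> measurable (path_space {..t}) S"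
    by (rule measurable_component_singleton) simp
  have measurable_extend: "(\<lambda>\<omega>. distr (K t (\<omega> t)) (path_space {..Suc t}) (?extend \<omega>))
      \<in> measurable (path_space {..t}) (subprob_algebra (path_space {..Suc t}))"
    by (rule measurable_distr2[OF measurable_path_extension measurable_compose[OF coord K_subprob]])
  have "distr P (S \<Otimes>\<^sub>M S) ?pair = distr (fdd Om x K (Suc t)) (S \<Otimes>\<^sub>M S) ?pair"
    using distr_pathmeas_eq_distr_fdd[OF pair] by simp
  also have "\<dots> = fdd Om x K t \<bind> (\<lambda>\<omega>. distr (distr (K t (\<omega> t)) (path_space {..Suc t}) (?extend \<omega>))
    (S \<Otimes>\<^sub>M S) ?pair)"
    unfolding fdd.simps using measurable_extend prob_space.not_empty[OF prob_space_fdd]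
    by (intro distr_bind[OF _ _ pair]) (simp_all add: measurable_cong_sets[OF sets_fdd refl])
  also have "\<dots> = fdd Om x K t \<bind> (\<lambda>\<omega>. transition t (\<omega> t))"
  proof (intro bind_cong refl)
    fix \<omega> assume "\<omega> \<in> space (fdd Om x K t)"
    then have \<omega>: "\<omega> \<in> space (path_space {..t})" by (simp add: space_fdd)
    then have "\<omega> t \<in> Om" by (auto simp: space_PiM)
    have "?extend \<omega> \<in> measurable (K t (\<omega> t)) (path_space {..Suc t})"
      unfolding measurable_cong_sets[OF sets_K[OF \<open>\<omega> t \<in> Om\<close>] refl]
      using measurable_compose[OF measurable_Pair1'[OF \<omega>] measurable_path_extension] by simp
    from distr_distr[OF pair this]
    show "distr (distr (K t (\<omega> t)) (path_space {..Suc t}) (?extend \<omega>)) (S \<Otimes>\<^sub>M S) ?pair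
        = transition t (\<omega> t)"
      by (simp add: comp_def)
  qed
  also have "\<dots> = law t \<bind> transition t"
    unfolding law_eq_distr_fdd using coord prob_space.not_empty[OF prob_space_fdd]
    by (intro bind_distr[OF _ measurable_transition, symmetric])
      (simp_all add: measurable_cong_sets[OF sets_fdd refl])
  finally show ?thesis .
qed

lemma nn_integral_law_Suc:
  assumes f: "f \<in> borel_measurable S"
  shows "(\<integral>\<^sup>+y. f y \<partial>law (Suc t)) = (\<integral>\<^sup>+u. (\<integral>\<^sup>+y. f y \<partial>K t u) \<partial>law t)"
proof -
  have f_snd: "(\<lambda>z. f (snd z)) \<in> borel_measurable (S \<Otimes>\<^sub>M S)"
    by (rule measurable_compose[OF measurable_snd f])
  have "(\<integral>\<^sup>+y. f y \<partial>law (Suc t)) = (\<integral>\<^sup>+z. f (snd z) \<partial>distr P (S \<Otimes>\<^sub>M S) (\<lambda>\<omega>. (\<omega> t, \<omega> (Suc t))))"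
    unfolding law_def using f f_snd by (simp add: nn_integral_distr)
  also have "\<dots> = (\<integral>\<^sup>+u. (\<integral>\<^sup>+z. f (snd z) \<partial>transition t u) \<partial>law t)"
    unfolding distr_pathmeas_transition by (rule nn_integral_bind[OF f_snd measurable_transition_law])
  also have "\<dots> = (\<integral>\<^sup>+u. (\<integral>\<^sup>+y. f y \<partial>K t u) \<partial>law t)"
    using f_snd by (intro nn_integral_cong) (simp add: nn_integral_distr measurable_cong_sets[OF sets_K refl])
  finally show ?thesis .
qed

lemma has_bochner_integral_transition:
  fixes f :: "'x \<Rightarrow> 'x \<Rightarrow> real"
  assumes f: "case_prod f \<in> borel_measurable (S \<Otimes>\<^sub>M S)"
    and int: "integrable P (\<lambda>\<omega>. f (\<omega> t) (\<omega> (Suc t)))" "\<And>u. u \<in> Om \<Longrightarrow> integrable (K t u) (f u)"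
  shows "has_bochner_integral (law t) (\<lambda>u. \<integral>y. f u y \<partial>K t u) (\<integral>\<omega>. f (\<omega> t) (\<omega> (Suc t)) \<partial>P)"
proof -
  let ?pair = "\<lambda>\<omega>. (\<omega> t, \<omega> (Suc t))"
  have pair: "?pair \<in> measurable P (S \<Otimes>\<^sub>M S)"
    by (intro measurable_Pair measurable_coord)
  have Pair: "Pair u \<in> measurable (K t u) (S \<Otimes>\<^sub>M S)" if "u \<in> Om" for u
    using that by (simp add: measurable_cong_sets[OF sets_K refl])
  have "has_bochner_integral (law t) (\<lambda>u. \<integral>z. case_prod f z \<partial>transition t u)
    (\<integral>z. case_prod f z \<partial>(law t \<bind> transition t))"
  proof (rule has_bochner_integral_bind[OF measurable_transition_law f])
    show "integrable (law t \<bind> transition t) (case_prod f)"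
      unfolding distr_pathmeas_transition[symmetric] integrable_distr_eq[OF pair f] using int(1) by simp
    show "integrable (transition t u) (case_prod f)" if "u \<in> space (law t)" for u
      using int(2)[of u] that by (simp add: integrable_distr_eq[OF Pair f])
  qed
  also have "(\<integral>z. case_prod f z \<partial>(law t \<bind> transition t)) = (\<integral>\<omega>. f (\<omega> t) (\<omega> (Suc t)) \<partial>P)"
    unfolding distr_pathmeas_transition[symmetric] integral_distr[OF pair f] by simp
  finally show ?thesis
    by (subst has_bochner_integral_cong[OF refl _ refl]) (simp_all add: integral_distr[OF Pair f])
qed

end

section \<open>The Bellman operator\<close>

lemma tendsto_at_right_compose:
  fixes \<rho> :: "real \<Rightarrow> 'b::topological_space"
  assumes "(\<rho> \<longlongrightarrow> \<rho> c) (at_right c)" "(d \<longlongrightarrow> c) F" "\<And>z. c \<le> d z"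
  shows "((\<lambda>z. \<rho> (d z)) \<longlongrightarrow> \<rho> c) F"
proof -
  have "continuous (at c within {c..}) \<rho>"
    using assms(1) by (simp add: continuous_within at_within_Ici_at_right)
  from continuous_within_tendsto_compose'[OF this _ assms(2)] assms(3) show ?thesis
    by simp
qed

locale robust_mdp =
  fixes Om :: "'x::euclidean_space set" and A :: "'u::euclidean_space set"
    and Pc :: "'x \<Rightarrow> 'u \<Rightarrow> 'x measure set"
    and r :: "'x \<Rightarrow> 'u \<Rightarrow> 'x \<Rightarrow> real"
    and rho0 rhoA :: "real \<Rightarrow> ennreal"
    and p :: nat and CP Cr L \<alpha> :: real
  assumes Om: "closed Om" "Om \<noteq> {}"
    and A: "compact A" "A \<noteq> {}"
    and Pc: "\<forall>x\<in>Om. \<forall>a\<in>A. Pc x a \<noteq> {} \<and> compactin (tau p Om) (Pc x a)"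
    and Pc_uhc: "uhc (top_of_set (Om \<times> A)) (tau p Om) (\<lambda>(x, a). Pc x a)"
    and Pc_lhc: "lhc (top_of_set (Om \<times> A)) (tau p Om) (\<lambda>(x, a). Pc x a)"
    and CP: "CP \<ge> 1"
    and moment: "\<forall>x\<in>Om. \<forall>a\<in>A. \<forall>Q\<in>Pc x a.
        nn_integral Q (\<lambda>y. ennreal (1 + norm y ^ p)) \<le> ennreal (CP * (1 + norm x ^ p))"
    and r_cont: "continuous_on (Om \<times> A \<times> Om) (\<lambda>(x, a, y). r x a y)"
    and L: "L > 0"
    and rho0: "rho0 0 = 0" "(rho0 \<longlongrightarrow> 0) (at_right 0)"
    and rhoA: "rhoA 0 = 0" "(rhoA \<longlongrightarrow> 0) (at_right 0)"
    and r_mod: "\<forall>x0\<in>Om. \<forall>x0'\<in>Om. \<forall>x1\<in>Om. \<forall>a\<in>A. \<forall>a'\<in>A.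
        ennreal \<bar>r x0 a x1 - r x0' a' x1\<bar>
          \<le> ennreal (L * (1 + norm x1 ^ p)) * (rho0 (dist x0 x0') + rhoA (dist a a'))"
    and Cr: "Cr \<ge> 1"
    and r_growth: "\<forall>x0\<in>Om. \<forall>a\<in>A. \<forall>x1\<in>Om. \<bar>r x0 a x1\<bar> \<le> Cr * (1 + norm x0 ^ p + norm x1 ^ p)"
    and alpha: "0 < \<alpha>" "\<alpha> < 1 / CP"
begin

abbreviation \<T> :: "('x \<Rightarrow> real) \<Rightarrow> 'x \<Rightarrow> real" where
  "\<T> \<equiv> Tb A Pc r \<alpha>"

abbreviation stage_value :: "('x \<Rightarrow> real) \<Rightarrow> 'x \<Rightarrow> 'u \<Rightarrow> 'x measure \<Rightarrow> real" where
  "stage_value \<equiv> stageval r \<alpha>"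

abbreviation optimal_kernel :: "('x \<Rightarrow> real) \<Rightarrow> ('x \<times> 'u \<Rightarrow> 'x measure) \<Rightarrow> bool" where
  "optimal_kernel \<equiv> optkernel Om A Pc r \<alpha>"

abbreviation optimal_action :: "('x \<Rightarrow> real) \<Rightarrow> ('x \<Rightarrow> 'u) \<Rightarrow> bool" where
  "optimal_action \<equiv> optaction Om A Pc r \<alpha>"

abbreviation expected_totrew :: "(nat \<Rightarrow> 'x \<Rightarrow> 'u) \<Rightarrow> (nat \<Rightarrow> 'x) measure \<Rightarrow> real" where
  "expected_totrew a Q \<equiv> integral\<^sup>L Q (totrew r \<alpha> a)"

abbreviation reward_bound :: "'x \<Rightarrow> nat \<Rightarrow> real" where
  "reward_bound y t \<equiv> (\<alpha> * CP) ^ t * (Cr * (1 + CP) * weight p y)"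

sublocale scenarios: continuous_correspondence "top_of_set (Om \<times> A)" "tau p Om" "\<lambda>(x, a). Pc x a"
  using Pc Pc_uhc Pc_lhc by unfold_locales auto

sublocale actions: continuous_correspondence "top_of_set Om" "top_of_set A" "\<lambda>_. A"
  by (rule continuous_correspondence_const) (simp_all add: A compactin_subtopology)

lemma Pc_M1p: "x \<in> Om \<Longrightarrow> a \<in> A \<Longrightarrow> Q \<in> Pc x a \<Longrightarrow> Q \<in> M1p p Om"
  using compactin_subset_topspace[of "tau p Om" "Pc x a"] Pc by (auto simp: topspace_tau)

lemma integral_weight_le:
  assumes "x \<in> Om" "a \<in> A" "Q \<in> Pc x a"
  shows "integral\<^sup>L Q (weight p) \<le> CP * weight p x"
proof (rule M1pI(2))
  show "sets Q = sets (locsp Om)" "prob_space Q"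
    using M1pD[OF Pc_M1p[OF assms]] by auto
  show "(\<integral>\<^sup>+y. ennreal (weight p y) \<partial>Q) \<le> ennreal (CP * weight p x)"
    using moment assms by blast
  show "0 \<le> CP * weight p x"
    using CP by (intro mult_nonneg_nonneg less_imp_le[OF weight_pos]) simp
qed

lemma abs_r_le:
  assumes "x \<in> Om" "a \<in> A" "y \<in> Om"
  shows "\<bar>r x a y\<bar> \<le> Cr * weight p x + Cr * weight p y"
proof -
  have "\<bar>r x a y\<bar> \<le> Cr * (1 + norm x ^ p + norm y ^ p)" using r_growth assms by auto
  also have "\<dots> \<le> Cr * (weight p x + weight p y)" using Cr by (intro mult_left_mono) auto
  finally show ?thesis by (simp only: distrib_left)
qed

lemma r_Cp:
  assumes "x \<in> Om" "a \<in> A"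
  shows "r x a \<in> Cp p Om"
proof (rule CpI)
  have "continuous_on Om (\<lambda>y. case (x, a, y) of (x, a, y) \<Rightarrow> r x a y)"
    using assms by (intro continuous_on_compose2[OF r_cont] continuous_intros) auto
  then show "continuous_on Om (r x a)" by simp
  fix y assume "y \<in> Om"
  then have "\<bar>r x a y\<bar> \<le> Cr * weight p x + Cr * weight p y"
    by (rule abs_r_le[OF assms])
  also have "Cr * weight p x \<le> Cr * weight p x * weight p y"
    using mult_left_mono[of 1 "weight p y" "Cr * weight p x"] Cr by simp
  finally show "\<bar>r x a y\<bar> \<le> (Cr * weight p x + Cr) * weight p y"
    by (simp add: distrib_right)
qed

lemma stage_Cp: "v \<in> Cp p Om \<Longrightarrow> x \<in> Om \<Longrightarrow> a \<in> A \<Longrightarrow> (\<lambda>y. r x a y + \<alpha> * v y) \<in> Cp p Om"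
  by (intro Cp_add Cp_cmult r_Cp)

lemma r_uniform_in_successor:
  assumes z0: "z0 \<in> Om \<times> A" and e: "0 < e"
  shows "\<exists>U. openin (top_of_set (Om \<times> A)) U \<and> z0 \<in> U \<and>
    (\<forall>z\<in>U. \<forall>y\<in>Om. \<bar>r (fst z) (snd z) y - r (fst z0) (snd z0) y\<bar> \<le> e * weight p y)"
proof -
  let ?\<rho> = "\<lambda>z. rho0 (dist (fst z) (fst z0)) + rhoA (dist (snd z) (snd z0))"
  have "((\<lambda>z. dist (fst z) (fst z0)) \<longlongrightarrow> 0) (nhds z0)"
    by (rule tendsto_eq_rhs[OF tendsto_dist[OF tendsto_fst[OF filterlim_ident] tendsto_const]]) simp
  from tendsto_at_right_compose[OF _ this zero_le_dist, of rho0]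
  have state: "((\<lambda>z. rho0 (dist (fst z) (fst z0))) \<longlongrightarrow> 0) (nhds z0)"
    using rho0 by simp
  have "((\<lambda>z. dist (snd z) (snd z0)) \<longlongrightarrow> 0) (nhds z0)"
    by (rule tendsto_eq_rhs[OF tendsto_dist[OF tendsto_snd[OF filterlim_ident] tendsto_const]]) simp
  from tendsto_at_right_compose[OF _ this zero_le_dist, of rhoA]
  have action: "((\<lambda>z. rhoA (dist (snd z) (snd z0))) \<longlongrightarrow> 0) (nhds z0)"
    using rhoA by simp
  have "(?\<rho> \<longlongrightarrow> 0 + 0) (nhds z0)"
    by (rule tendsto_add[OF state action])
  then have "\<forall>\<^sub>F z in nhds z0. ?\<rho> z < ennreal (e / L)"
    using e L by (intro order_tendstoD(2)[where y = 0]) simp_all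
  then obtain U where U: "open U" "z0 \<in> U" "\<And>z. z \<in> U \<Longrightarrow> ?\<rho> z < ennreal (e / L)"
    by (auto simp: eventually_nhds)
  show ?thesis
  proof (intro exI[of _ "Om \<times> A \<inter> U"] conjI ballI)
    show "openin (top_of_set (Om \<times> A)) (Om \<times> A \<inter> U)" by (rule openin_open_Int[OF U(1)])
    show "z0 \<in> Om \<times> A \<inter> U" using z0 U(2) by blast
    fix z y assume z: "z \<in> Om \<times> A \<inter> U" and y: "y \<in> Om"
    have "ennreal \<bar>r (fst z) (snd z) y - r (fst z0) (snd z0) y\<bar> \<le> ennreal (L * weight p y) * ?\<rho> z"
      using r_mod[rule_format, of "fst z" "fst z0" y "snd z" "snd z0"] z z0 y by (simp add: mem_Times_iff)
    also have "\<dots> \<le> ennreal (L * weight p y) * ennreal (e / L)"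
      using z by (intro mult_left_mono less_imp_le[OF U(3)]) simp_all
    also have "\<dots> = ennreal (L * weight p y * (e / L))"
      using e L by (intro ennreal_mult'[symmetric]) simp
    also have "L * weight p y * (e / L) = e * weight p y" using L by simp
    finally show "\<bar>r (fst z) (snd z) y - r (fst z0) (snd z0) y\<bar> \<le> e * weight p y"
      using e weight_pos[of y p] by (subst (asm) ennreal_le_iff) simp_all
  qed
qed

lemma continuous_map_stageval:
  assumes v: "v \<in> Cp p Om"
  shows "continuous_map (prod_topology (top_of_set (Om \<times> A)) (tau p Om)) euclideanreal
    (\<lambda>(z, Q). stage_value v (fst z) (snd z) Q)"
  unfolding stageval_def
proof (rule continuous_map_param_integral_tau)
  show "(\<lambda>y. r (fst z) (snd z) y + \<alpha> * v y) \<in> Cp p Om" if "z \<in> Om \<times> A" for z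
    using that by (intro stage_Cp v) auto
qed (use r_uniform_in_successor in simp)

definition worst_value :: "('x \<Rightarrow> real) \<Rightarrow> 'x \<Rightarrow> 'u \<Rightarrow> real" where
  "worst_value v x a = (INF Q\<in>Pc x a. stage_value v x a Q)"

lemma worst_value_le:
  assumes "v \<in> Cp p Om" "x \<in> Om" "a \<in> A" "Q \<in> Pc x a"
  shows "worst_value v x a \<le> stage_value v x a Q"
  unfolding worst_value_def stageval_def
  using assms Pc by (intro compactin_INF_lower[of "tau p Om"] continuous_map_integral_tau stage_Cp) simp_all

lemma worst_value_attained:
  assumes "v \<in> Cp p Om" "x \<in> Om" "a \<in> A"
  obtains Q where "Q \<in> Pc x a" "stage_value v x a Q = worst_value v x a"
proof -
  have "compactin (tau p Om) (Pc x a)" "Pc x a \<noteq> {}"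
    using Pc assms(2,3) by auto
  from compactin_attains_INF[OF this continuous_map_integral_tau[OF stage_Cp[OF assms]]]
  show thesis
    unfolding worst_value_def stageval_def using that[unfolded worst_value_def stageval_def] by blast
qed

lemma continuous_on_worst_value:
  assumes "v \<in> Cp p Om"
  shows "continuous_on (Om \<times> A) (\<lambda>z. worst_value v (fst z) (snd z))"
  using scenarios.Berge_continuous_map_INF[OF continuous_map_stageval[OF assms]]
  by (simp add: worst_value_def case_prod_beta')

lemma Tb_eq_SUP: "\<T> v x = (SUP a\<in>A. worst_value v x a)"
  by (simp add: Tb_def worst_value_def)

lemma continuous_map_uminus_worst_value:
  assumes "v \<in> Cp p Om"
  shows "continuous_map (prod_topology (top_of_set Om) (top_of_set A)) euclideanreal
    (\<lambda>(x, a). - worst_value v x a)"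
  using continuous_on_worst_value[OF assms]
  by (simp add: case_prod_beta' prod_topology_subtopology_eu)

lemma Tb_eq_uminus_INF: "\<T> v x = - (INF a\<in>A. - worst_value v x a)"
  unfolding Tb_eq_SUP by (simp add: Inf_real_def image_image)

lemma continuous_on_Tb:
  assumes "v \<in> Cp p Om"
  shows "continuous_on Om (\<T> v)"
proof -
  have "continuous_on Om (\<lambda>x. INF a\<in>A. - worst_value v x a)"
    using actions.Berge_continuous_map_INF[OF continuous_map_uminus_worst_value[OF assms]] by simp
  from continuous_on_minus[OF this] show ?thesis
    by (simp add: Tb_eq_uminus_INF[abs_def])
qed

lemma optkernel_exists:
  assumes v: "v \<in> Cp p Om"
  shows "\<exists>P0. optimal_kernel v P0"
proof -
  let ?M = "restrict_space borel (Om \<times> A) :: ('x \<times> 'u) measure"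
  obtain g :: "nat \<Rightarrow> 'x \<Rightarrow> real"
    where g: "\<And>n. continuous_on UNIV (g n)" "\<And>n x. \<bar>g n x\<bar> \<le> 1"
    and kernelI: "\<And>K. (\<And>z. z \<in> space ?M \<Longrightarrow> prob_space (K z)) \<Longrightarrow>
      (\<And>z. z \<in> space ?M \<Longrightarrow> sets (K z) = sets (locsp Om)) \<Longrightarrow>
      (\<And>n. (\<lambda>z. \<integral>y. g n y \<partial>K z) \<in> borel_measurable ?M) \<Longrightarrow> K \<in> measurable ?M (prob_algebra (locsp Om))"
    by (rule continuous_functions_determine_kernels[OF borel_closed[OF Om(1)]]) blast
  define f where "f n z Q = (case n of 0 \<Rightarrow> stage_value v (fst z) (snd z) Q | Suc m \<Rightarrow> integral\<^sup>L Q (g m))"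
    for n :: nat and z Q
  have continuous: "continuous_map (prod_topology (top_of_set (Om \<times> A)) (tau p Om)) euclideanreal
    (case_prod (f n))" for n
  proof (cases n)
    case 0
    then show ?thesis using continuous_map_stageval[OF v] by (simp add: f_def case_prod_beta')
  next
    case (Suc m)
    have "g m \<in> Cp p Om"
      using g by (intro Cp_bounded) (auto intro: continuous_on_subset)
    from continuous_map_integral_tau_snd[OF this] show ?thesis
      by (simp add: f_def Suc case_prod_beta')
  qed
  obtain s where s: "\<And>x a. x \<in> Om \<Longrightarrow> a \<in> A \<Longrightarrow> s (x, a) \<in> Pc x a \<and>
    f 0 (x, a) (s (x, a)) = (INF Q\<in>Pc x a. f 0 (x, a) Q)"
    and s_measurable: "\<And>n. (\<lambda>z. f n z (s z)) \<in> borel_measurable ?M"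
    using scenarios.measurable_argmin_selection[where f = f and M = ?M,
      OF _ borel_measurable_continuous_map_restrict continuous]
    by (auto simp: space_restrict_space)
  have "s \<in> measurable ?M (prob_algebra (locsp Om))"
  proof (rule kernelI)
    fix z assume "z \<in> space ?M"
    then have "s z \<in> M1p p Om"
      using s Pc_M1p by (auto simp: space_restrict_space)
    then show "prob_space (s z)" "sets (s z) = sets (locsp Om)"
      using M1pD by blast+
  next
    show "(\<lambda>z. \<integral>y. g n y \<partial>s z) \<in> borel_measurable ?M" for n
      using s_measurable[of "Suc n"] by (simp add: f_def)
  qed
  then have "optimal_kernel v s"
    using s unfolding optkernel_def by (simp add: f_def)
  then show ?thesis by blast
qed

lemma Aloc_in: "a \<in> Aloc Om A \<Longrightarrow> x \<in> Om \<Longrightarrow> a x \<in> A"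
  unfolding Aloc_def using measurable_space[of a "locsp Om" "restrict_space borel A" x]
  by (simp add: space_restrict_space)

lemma Aloc_borel_measurable: "a \<in> Aloc Om A \<Longrightarrow> a \<in> borel_measurable (locsp Om)"
  unfolding Aloc_def measurable_restrict_space2_iff by simp

lemma SUP_Aloc_eq_Tb:
  assumes "x \<in> Om"
  shows "(SUP a\<in>Aloc Om A. worst_value v x (a x)) = \<T> v x"
proof -
  have "(\<lambda>_. a) \<in> Aloc Om A" if "a \<in> A" for a
    using that unfolding Aloc_def by (intro measurable_restrict_space2) auto
  then have "(\<lambda>a. a x) ` Aloc Om A = A"
    using Aloc_in[OF _ assms] by force
  then have "worst_value v x ` A = (\<lambda>a. worst_value v x (a x)) ` Aloc Om A"
    by (metis image_image)
  then show ?thesis by (simp add: Tb_eq_SUP)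
qed

lemma optaction_iff:
  "optimal_action v as \<longleftrightarrow> as \<in> Aloc Om A \<and> (\<forall>x\<in>Om. worst_value v x (as x) = \<T> v x)"
  unfolding optaction_def worst_value_def[symmetric] using SUP_Aloc_eq_Tb by auto

lemma optaction_exists:
  assumes v: "v \<in> Cp p Om"
  shows "\<exists>as. optimal_action v as"
proof -
  define f where "f n x a = (case n of 0 \<Rightarrow> - worst_value v x a | Suc m \<Rightarrow> a \<bullet> from_nat_into Basis m)"
    for n :: nat and x a
  have continuous: "continuous_map (prod_topology (top_of_set Om) (top_of_set A)) euclideanreal
    (case_prod (f n))" for n
  proof (cases n)
    case 0
    then show ?thesis using continuous_map_uminus_worst_value[OF v] by (simp add: f_def case_prod_beta')
  next
    case (Suc m)
    then show ?thesis
      by (simp add: f_def case_prod_beta' prod_topology_subtopology_eu) (intro continuous_intros)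
  qed
  obtain s where s: "\<And>x. x \<in> Om \<Longrightarrow> s x \<in> A \<and> f 0 x (s x) = (INF a\<in>A. f 0 x a)"
    and s_measurable: "\<And>n. (\<lambda>x. f n x (s x)) \<in> borel_measurable (locsp Om)"
    using actions.measurable_argmin_selection[where f = f and M = "locsp Om",
      OF _ borel_measurable_continuous_map_restrict continuous]
    by (auto simp: space_restrict_space Ball_def)
  have "s \<in> borel_measurable (locsp Om)"
  proof (subst borel_measurable_euclidean_space, intro ballI)
    fix b :: 'u assume "b \<in> Basis"
    then obtain m where "from_nat_into Basis m = b"
      using from_nat_into_surj[OF countable_finite[OF finite_Basis]] by metis
    then show "(\<lambda>x. s x \<bullet> b) \<in> borel_measurable (locsp Om)"
      using s_measurable[of "Suc m"] by (simp add: f_def)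
  qed
  then have "s \<in> Aloc Om A"
    unfolding Aloc_def using s by (intro measurable_restrict_space2) (auto simp: space_restrict_space)
  moreover have "worst_value v x (s x) = \<T> v x" if "x \<in> Om" for x
    using s[OF that] by (simp add: f_def Tb_eq_uminus_INF)
  ultimately show ?thesis
    by (auto simp: optaction_iff)
qed

lemma worst_value_le_Tb:
  assumes "v \<in> Cp p Om" "x \<in> Om" "a \<in> A"
  shows "worst_value v x a \<le> \<T> v x"
proof -
  have "(INF a\<in>A. - worst_value v x a) \<le> - worst_value v x a"
    using compactin_INF_lower[OF actions.compactin_values
        continuous_map_prod_slice[OF continuous_map_uminus_worst_value[OF assms(1)]]] assms(2,3) by simp
  then show ?thesis by (simp add: Tb_eq_uminus_INF)
qed

lemma Tb_attained:
  assumes "v \<in> Cp p Om" "x \<in> Om"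
  obtains a where "a \<in> A" "worst_value v x a = \<T> v x"
  using optaction_exists[OF assms(1)] assms(2) Aloc_in unfolding optaction_iff by metis

lemma abs_stageval_le:
  assumes v: "v \<in> Cp p Om" "0 \<le> c" "\<And>y. y \<in> Om \<Longrightarrow> \<bar>v y\<bar> \<le> c * weight p y"
    and xa: "x \<in> Om" "a \<in> A" and Q: "Q \<in> Pc x a"
  shows "\<bar>stage_value v x a Q\<bar> \<le> (Cr + (Cr + \<alpha> * c) * CP) * weight p x"
proof -
  have "\<bar>r x a y + \<alpha> * v y\<bar> \<le> Cr * weight p x + (Cr + \<alpha> * c) * weight p y" if y: "y \<in> Om" for y
  proof -
    have "\<bar>\<alpha> * v y\<bar> \<le> \<alpha> * c * weight p y"
      using mult_left_mono[OF v(3)[OF y], of \<alpha>] alpha by (simp add: abs_mult mult.assoc)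
    then show ?thesis
      using abs_r_le[OF xa y] unfolding distrib_right[of Cr] by linarith
  qed
  then have "\<bar>stage_value v x a Q\<bar> \<le> Cr * weight p x + (Cr + \<alpha> * c) * integral\<^sup>L Q (weight p)"
    unfolding stageval_def by (intro abs_integral_le_weight[OF Pc_M1p[OF xa Q]] stage_Cp v(1) xa)
  also have "\<dots> \<le> Cr * weight p x + (Cr + \<alpha> * c) * (CP * weight p x)"
    using integral_weight_le[OF xa Q] Cr alpha v(2) by (intro add_left_mono mult_left_mono) auto
  finally show ?thesis by (simp add: algebra_simps)
qed

lemma Tb_Cp:
  assumes v: "v \<in> Cp p Om"
  shows "\<T> v \<in> Cp p Om"
proof -
  obtain c where c: "0 \<le> c" "\<And>y. y \<in> Om \<Longrightarrow> \<bar>v y\<bar> \<le> c * weight p y" using CpE[OF v] by metis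
  show ?thesis
  proof (rule CpI[OF continuous_on_Tb[OF v]])
    fix x assume x: "x \<in> Om"
    obtain a where a: "a \<in> A" "worst_value v x a = \<T> v x" using Tb_attained[OF v x] .
    obtain Q where Q: "Q \<in> Pc x a" "stage_value v x a Q = worst_value v x a"
      using worst_value_attained[OF v x a(1)] .
    show "\<bar>\<T> v x\<bar> \<le> (Cr + (Cr + \<alpha> * c) * CP) * weight p x"
      using abs_stageval_le[OF v c x a(1) Q(1)] Q(2) a(2) by simp
  qed
qed

lemma abs_stageval_diff_le:
  assumes v: "v \<in> Cp p Om" and u: "u \<in> Cp p Om" and xa: "x \<in> Om" "a \<in> A" and Q: "Q \<in> Pc x a"
  shows "\<bar>stage_value v x a Q - stage_value u x a Q\<bar> \<le> \<alpha> * CP * cpnorm p Om (\<lambda>x. v x - u x) * weight p x"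
proof -
  let ?c = "cpnorm p Om (\<lambda>x. v x - u x)"
  note vu = Cp_diff[OF v u]
  have "\<bar>(r x a y + \<alpha> * v y) - (r x a y + \<alpha> * u y)\<bar> \<le> \<alpha> * ?c * weight p y" if "y \<in> Om" for y
    using mult_left_mono[OF abs_le_cpnorm[OF vu that], of \<alpha>] alpha
    by (simp add: abs_mult mult.assoc flip: right_diff_distrib)
  then have "\<bar>stage_value v x a Q - stage_value u x a Q\<bar> \<le> \<alpha> * ?c * integral\<^sup>L Q (weight p)"
    unfolding stageval_def by (intro abs_integral_diff_le_weight[OF Pc_M1p[OF xa Q]] stage_Cp v u xa)
  also have "\<dots> \<le> \<alpha> * ?c * (CP * weight p x)"
    using alpha by (intro mult_left_mono integral_weight_le[OF xa Q] mult_nonneg_nonneg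
      cpnorm_nonneg[OF Om(2) vu]) simp
  finally show ?thesis by (simp add: mult_ac)
qed

lemma Tb_le_Tb_add:
  assumes v: "v \<in> Cp p Om" and u: "u \<in> Cp p Om" and x: "x \<in> Om"
  shows "\<T> v x \<le> \<T> u x + \<alpha> * CP * cpnorm p Om (\<lambda>x. v x - u x) * weight p x"
proof -
  obtain a where a: "a \<in> A" "worst_value v x a = \<T> v x" using Tb_attained[OF v x] .
  obtain Q where Q: "Q \<in> Pc x a" "stage_value u x a Q = worst_value u x a"
    using worst_value_attained[OF u x a(1)] .
  have "\<T> v x \<le> stage_value v x a Q"
    using worst_value_le[OF v x a(1) Q(1)] a(2) by simp
  also have "\<dots> \<le> stage_value u x a Q + \<alpha> * CP * cpnorm p Om (\<lambda>x. v x - u x) * weight p x"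
    using abs_stageval_diff_le[OF v u x a(1) Q(1)] by linarith
  also have "stage_value u x a Q \<le> \<T> u x"
    using worst_value_le_Tb[OF u x a(1)] Q(2) by simp
  finally show ?thesis by simp
qed

lemma Tb_contraction:
  assumes "v \<in> Cp p Om" "u \<in> Cp p Om"
  shows "cpnorm p Om (\<lambda>x. \<T> v x - \<T> u x) \<le> \<alpha> * CP * cpnorm p Om (\<lambda>x. v x - u x)"
proof -
  have "cpnorm p Om (\<lambda>x. u x - v x) = cpnorm p Om (\<lambda>x. v x - u x)"
    by (simp add: cpnorm_def abs_minus_commute)
  then have "\<bar>\<T> v x - \<T> u x\<bar> \<le> \<alpha> * CP * cpnorm p Om (\<lambda>x. v x - u x) * weight p x" if "x \<in> Om" for x
    using Tb_le_Tb_add[OF assms that] Tb_le_Tb_add[OF assms(2,1) that] by (simp add: abs_le_iff)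
  then show ?thesis
    using cpnorm_le_iff[OF Om(2) Cp_diff[OF Tb_Cp Tb_Cp]] assms by blast
qed

lemma discount_factor: "0 < \<alpha> * CP" "\<alpha> * CP < 1"
  using alpha CP by (auto simp: pos_less_divide_eq)

sublocale bellman: Cp_contraction p Om "\<T>" "\<alpha> * CP"
  using Om discount_factor Tb_Cp Tb_contraction by unfold_locales auto

lemma optkernelD:
  assumes "optimal_kernel v P0"
  shows "P0 \<in> measurable (restrict_space borel (Om \<times> A)) (prob_algebra (locsp Om))"
    "x \<in> Om \<Longrightarrow> a \<in> A \<Longrightarrow> P0 (x, a) \<in> Pc x a"
    "x \<in> Om \<Longrightarrow> a \<in> A \<Longrightarrow> stage_value v x a (P0 (x, a)) = worst_value v x a"
  using assms by (auto simp: optkernel_def worst_value_def)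

lemma optkernel_Kset:
  assumes P0: "optimal_kernel v P0" and a: "a \<in> Aloc Om A"
  shows "(\<lambda>x. P0 (x, a x)) \<in> Kset Om Pc a"
proof -
  have "(\<lambda>x. (x, a x)) \<in> borel_measurable (locsp Om)"
    by (intro borel_measurable_Pair Aloc_borel_measurable[OF a] measurable_restrict_space1) simp
  then have "(\<lambda>x. (x, a x)) \<in> measurable (locsp Om) (restrict_space borel (Om \<times> A))"
    using Aloc_in[OF a] by (intro measurable_restrict_space2) (auto simp: space_restrict_space)
  from measurable_compose[OF this optkernelD(1)[OF P0]] show ?thesis
    unfolding Kset_def using optkernelD(2)[OF P0] Aloc_in[OF a] by auto
qed

lemma INF_Kset_eq_worst_value:
  assumes v: "v \<in> Cp p Om" and a: "a \<in> Aloc Om A" and x: "x \<in> Om"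
  shows "(INF K\<in>Kset Om Pc a. stage_value v x (a x) (K x)) = worst_value v x (a x)"
proof -
  obtain P0 where P0: "optimal_kernel v P0" using optkernel_exists[OF v] by blast
  show ?thesis
  proof (rule cInf_eq_minimum)
    show "worst_value v x (a x) \<in> (\<lambda>K. stage_value v x (a x) (K x)) ` Kset Om Pc a"
      using optkernel_Kset[OF P0 a] optkernelD(3)[OF P0 x Aloc_in[OF a x]] by (intro image_eqI) auto
    show "worst_value v x (a x) \<le> y" if "y \<in> (\<lambda>K. stage_value v x (a x) (K x)) ` Kset Om Pc a" for y
      using that x a by (auto simp: Kset_def intro!: worst_value_le v Aloc_in)
  qed
qed

lemma local_optimality:
  assumes v: "v \<in> Cp p Om" and P0: "optimal_kernel v P0" and as: "optimal_action v as" and x: "x \<in> Om"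
  shows "\<T> v x = (SUP a'\<in>Aloc Om A. INF K\<in>Kset Om Pc a'. stage_value v x (a' x) (K x))"
    "\<T> v x = (INF K\<in>Kset Om Pc as. stage_value v x (as x) (K x))"
    "\<T> v x = stage_value v x (as x) (P0 (x, as x))"
proof -
  have as_Aloc: "as \<in> Aloc Om A" and as_Tb: "worst_value v x (as x) = \<T> v x"
    using as x by (auto simp: optaction_iff)
  show "\<T> v x = (SUP a'\<in>Aloc Om A. INF K\<in>Kset Om Pc a'. stage_value v x (a' x) (K x))"
    unfolding SUP_Aloc_eq_Tb[OF x, symmetric] by (intro SUP_cong refl INF_Kset_eq_worst_value[symmetric] v x)
  show "\<T> v x = (INF K\<in>Kset Om Pc as. stage_value v x (as x) (K x))"
    using INF_Kset_eq_worst_value[OF v as_Aloc x] as_Tb by simp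
  show "\<T> v x = stage_value v x (as x) (P0 (x, as x))"
    using optkernelD(3)[OF P0 x Aloc_in[OF as_Aloc x]] as_Tb by simp
qed

end

section \<open>Evaluation of a policy under an admissible path measure\<close>

locale robust_path =
  robust_mdp Om A Pc r rho0 rhoA p CP Cr L \<alpha> + kernel_path Om x K
  for Om :: "'x::euclidean_space set" and A :: "'u::euclidean_space set"
    and Pc r rho0 rhoA p CP Cr L \<alpha> x K +
  fixes a :: "nat \<Rightarrow> 'x \<Rightarrow> 'u"
  assumes policy: "a \<in> Apol Om A" and K_Pc: "\<And>t y. y \<in> Om \<Longrightarrow> K t y \<in> Pc y (a t y)"
begin

abbreviation "reward t \<omega> \<equiv> r (\<omega> t) (a t (\<omega> t)) (\<omega> (Suc t))"
abbreviation "step_value v t u \<equiv> stage_value v u (a t u) (K t u)"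

lemma a_Aloc: "a t \<in> Aloc Om A" using policy by (simp add: Apol_def)

lemma a_in: "y \<in> Om \<Longrightarrow> a t y \<in> A" using Aloc_in[OF a_Aloc] .

lemma K_M1p: "y \<in> Om \<Longrightarrow> K t y \<in> M1p p Om"
  using Pc_M1p[OF _ a_in K_Pc] by blast

lemma nn_integral_law_weight_le: "(\<integral>\<^sup>+y. ennreal (weight p y) \<partial>law t) \<le> ennreal (CP ^ t * weight p x)"
proof (induction t)
  case 0
  show ?case
    unfolding law_0 using start by (subst nn_integral_return[OF _ borel_measurable_ennreal_weight]) simp_all
next
  case (Suc t)
  have "(\<integral>\<^sup>+y. ennreal (weight p y) \<partial>law (Suc t)) = (\<integral>\<^sup>+u. (\<integral>\<^sup>+y. ennreal (weight p y) \<partial>K t u) \<partial>law t)"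
    by (rule nn_integral_law_Suc[OF borel_measurable_ennreal_weight])
  also have "\<dots> \<le> (\<integral>\<^sup>+u. ennreal CP * ennreal (weight p u) \<partial>law t)"
  proof (rule nn_integral_mono)
    fix u assume "u \<in> space (law t)"
    then have u: "u \<in> Om" by simp
    then have "(\<integral>\<^sup>+y. ennreal (weight p y) \<partial>K t u) \<le> ennreal (CP * weight p u)"
      using moment a_in[OF u] K_Pc[OF u] by blast
    then show "(\<integral>\<^sup>+y. ennreal (weight p y) \<partial>K t u) \<le> ennreal CP * ennreal (weight p u)"
      using CP by (simp add: ennreal_mult')
  qed
  also have "\<dots> = ennreal CP * (\<integral>\<^sup>+u. ennreal (weight p u) \<partial>law t)"
    by (rule nn_integral_cmult) (simp only: measurable_cong_sets[OF sets_law refl]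
      borel_measurable_ennreal_weight)
  also have "\<dots> \<le> ennreal CP * ennreal (CP ^ t * weight p x)"
    by (intro mult_left_mono Suc.IH) simp
  also have "\<dots> = ennreal (CP ^ Suc t * weight p x)"
    using CP by (simp add: ennreal_mult'[symmetric] mult.assoc)
  finally show ?case .
qed

lemma law_M1p: "law t \<in> M1p p Om"
  and integral_law_weight_le: "integral\<^sup>L (law t) (weight p) \<le> CP ^ t * weight p x"
proof -
  have "0 \<le> CP ^ t * weight p x"
    using CP by (intro mult_nonneg_nonneg less_imp_le[OF weight_pos]) simp
  from M1pI[OF sets_law prob_space_law nn_integral_law_weight_le this]
  show "law t \<in> M1p p Om" "integral\<^sup>L (law t) (weight p) \<le> CP ^ t * weight p x" .
qed

lemma integrable_coord:
  assumes "g \<in> Cp p Om"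
  shows "integrable P (\<lambda>\<omega>. g (\<omega> t))"
  using integrable_Cp[OF assms law_M1p] integrable_distr_eq[OF measurable_coord Cp_borel_measurable[OF assms]]
  by (simp add: law_def)

lemma integral_coord:
  assumes "g \<in> Cp p Om"
  shows "(\<integral>\<omega>. g (\<omega> t) \<partial>P) = integral\<^sup>L (law t) g"
  unfolding law_def by (rule integral_distr[OF measurable_coord Cp_borel_measurable[OF assms], symmetric])

lemma discounted_expectation_tendsto_0:
  assumes g: "g \<in> Cp p Om"
  shows "(\<lambda>t. \<alpha> ^ t * integral\<^sup>L (law t) g) \<longlonglongrightarrow> 0"
proof -
  obtain C where C: "0 \<le> C" "\<And>y. y \<in> Om \<Longrightarrow> \<bar>g y\<bar> \<le> C * weight p y" using CpE[OF g] by metis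
  have "norm (\<alpha> ^ t * integral\<^sup>L (law t) g) \<le> (\<alpha> * CP) ^ t * (C * weight p x)" for t
  proof -
    have "\<bar>integral\<^sup>L (law t) g\<bar> \<le> 0 + C * integral\<^sup>L (law t) (weight p)"
      using C(2) by (intro abs_integral_le_weight[OF law_M1p g]) simp
    also have "\<dots> \<le> C * (CP ^ t * weight p x)"
      using mult_left_mono[OF integral_law_weight_le C(1)] by simp
    finally have "\<alpha> ^ t * \<bar>integral\<^sup>L (law t) g\<bar> \<le> \<alpha> ^ t * (C * (CP ^ t * weight p x))"
      using alpha by (intro mult_left_mono) auto
    then show ?thesis using alpha by (simp add: abs_mult power_mult_distrib mult_ac)
  qed
  moreover have "(\<lambda>t. (\<alpha> * CP) ^ t * (C * weight p x)) \<longlonglongrightarrow> 0"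
    using discount_factor by (intro tendsto_mult_left_zero LIMSEQ_power_zero) auto
  ultimately show ?thesis
    by (rule Lim_null_comparison[OF always_eventually[OF allI]])
qed

lemma borel_measurable_r_policy: "(\<lambda>(u, y). r u (a t u) y) \<in> borel_measurable (S \<Otimes>\<^sub>M S)"
proof -
  have ident: "(\<lambda>y. y) \<in> borel_measurable S" by (rule measurable_restrict_space1) simp
  have "(\<lambda>z. (fst z, a t (fst z), snd z)) \<in> borel_measurable (S \<Otimes>\<^sub>M S)"
    by (intro borel_measurable_Pair measurable_compose[OF measurable_fst ident]
      measurable_compose[OF measurable_snd ident]
        measurable_compose[OF measurable_fst Aloc_borel_measurable[OF a_Aloc]])
  then have "(\<lambda>z. (fst z, a t (fst z), snd z)) \<in> measurable (S \<Otimes>\<^sub>M S) (restrict_space borel (Om \<times> A \<times> Om))"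
    using a_in by (intro measurable_restrict_space2) (auto simp: space_pair_measure)
  from measurable_compose[OF this borel_measurable_continuous_on_restrict[OF r_cont]]
  show ?thesis by (simp add: case_prod_beta')
qed

lemma integrable_reward: "integrable P (reward t)"
  and integral_abs_reward_le: "(\<integral>\<omega>. \<bar>reward t \<omega>\<bar> \<partial>P) \<le> CP ^ t * (Cr * (1 + CP) * weight p x)"
proof -
  have bound: "\<bar>reward t \<omega>\<bar> \<le> Cr * weight p (\<omega> t) + Cr * weight p (\<omega> (Suc t))" if "\<omega> \<in> space P" for \<omega>
    by (rule abs_r_le[OF coord_in_Om[OF that] a_in[OF coord_in_Om[OF that]] coord_in_Om[OF that]])
  have weights: "integrable P (\<lambda>\<omega>. Cr * weight p (\<omega> t))" for t
    by (intro integrable_mult_right integrable_coord weight_Cp)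
  show reward: "integrable P (reward t)"
  proof (rule Bochner_Integration.integrable_bound[OF Bochner_Integration.integrable_add[OF weights weights]])
    show "reward t \<in> borel_measurable P"
      using measurable_compose[OF measurable_Pair[OF measurable_coord measurable_coord]
          borel_measurable_r_policy] by simp
    show "AE \<omega> in P. norm (reward t \<omega>) \<le> norm (Cr * weight p (\<omega> t) + Cr * weight p (\<omega> (Suc t)))"
      using order_trans[OF bound abs_ge_self] by (intro AE_I2) simp
  qed
  have "(\<integral>\<omega>. \<bar>reward t \<omega>\<bar> \<partial>P) \<le> (\<integral>\<omega>. Cr * weight p (\<omega> t) + Cr * weight p (\<omega> (Suc t)) \<partial>P)"
    by (rule integral_mono[OF integrable_abs[OF reward] Bochner_Integration.integrable_add[OF weights weights]
      bound])
  also have "\<dots> = Cr * integral\<^sup>L (law t) (weight p) + Cr * integral\<^sup>L (law (Suc t)) (weight p)"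
    by (simp only: Bochner_Integration.integral_add[OF weights weights] integral_mult_right_zero
      integral_coord[OF weight_Cp])
  also have "\<dots> \<le> Cr * (CP ^ t * weight p x) + Cr * (CP ^ Suc t * weight p x)"
    using Cr by (intro add_mono mult_left_mono integral_law_weight_le) auto
  also have "\<dots> = CP ^ t * (Cr * (1 + CP) * weight p x)" by (simp add: algebra_simps)
  finally show "(\<integral>\<omega>. \<bar>reward t \<omega>\<bar> \<partial>P) \<le> CP ^ t * (Cr * (1 + CP) * weight p x)" .
qed

lemma summable_reward_bound: "summable (reward_bound x)"
  using discount_factor by (intro summable_mult2 summable_geometric) auto

lemma integral_abs_discounted_reward_le:
  "(\<integral>\<omega>. \<bar>\<alpha> ^ t * reward t \<omega>\<bar> \<partial>P) \<le> reward_bound x t"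
proof -
  have "(\<integral>\<omega>. \<bar>\<alpha> ^ t * reward t \<omega>\<bar> \<partial>P) = \<alpha> ^ t * (\<integral>\<omega>. \<bar>reward t \<omega>\<bar> \<partial>P)"
    using alpha by (simp add: abs_mult)
  also have "\<dots> \<le> \<alpha> ^ t * (CP ^ t * (Cr * (1 + CP) * weight p x))"
    using alpha by (intro mult_left_mono integral_abs_reward_le) auto
  finally show ?thesis by (simp only: power_mult_distrib mult.assoc)
qed

lemma expected_totrew_sums: "(\<lambda>t. \<alpha> ^ t * (\<integral>\<omega>. reward t \<omega> \<partial>P)) sums expected_totrew a P"
proof -
  have "summable (\<lambda>t. \<integral>\<omega>. \<bar>\<alpha> ^ t * reward t \<omega>\<bar> \<partial>P)"
    by (rule summable_comparison_test'[OF summable_reward_bound, of 0])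
      (use integral_abs_discounted_reward_le in simp)
  from sums_integral_real[OF integrable_mult_right[OF integrable_reward] this]
  show ?thesis by (simp add: totrew_def[abs_def])
qed

lemma abs_expected_totrew_le:
  "\<bar>expected_totrew a P\<bar> \<le> (\<Sum>t. reward_bound x t)"
proof -
  have "norm (\<alpha> ^ t * (\<integral>\<omega>. reward t \<omega> \<partial>P)) \<le> reward_bound x t" for t
    using integral_abs_bound[of P "\<lambda>\<omega>. \<alpha> ^ t * reward t \<omega>"] integral_abs_discounted_reward_le[of t] by simp
  from norm_suminf_le[OF this summable_reward_bound] show ?thesis
    using sums_unique[OF expected_totrew_sums] by simp
qed

lemma has_bochner_integral_step_value:
  assumes v: "v \<in> Cp p Om"
  shows "has_bochner_integral (law t) (step_value v t) ((\<integral>\<omega>. reward t \<omega> \<partial>P) + \<alpha> * integral\<^sup>L (law (Suc t)) v)"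
proof -
  have v_Suc: "integrable P (\<lambda>\<omega>. \<alpha> * v (\<omega> (Suc t)))"
    by (intro integrable_mult_right integrable_coord v)
  have "(\<lambda>z. v (snd z)) \<in> borel_measurable (S \<Otimes>\<^sub>M S)"
    by (rule measurable_compose[OF measurable_snd Cp_borel_measurable[OF v]])
  then have measurable: "(\<lambda>(u, y). r u (a t u) y + \<alpha> * v y) \<in> borel_measurable (S \<Otimes>\<^sub>M S)"
    using borel_measurable_r_policy[of t] unfolding case_prod_beta'
    by (intro borel_measurable_add borel_measurable_times borel_measurable_const)
  have integrable: "integrable (K t u) (\<lambda>y. r u (a t u) y + \<alpha> * v y)" if "u \<in> Om" for u
    using that by (intro integrable_Cp[OF _ K_M1p] stage_Cp v a_in)
  have "has_bochner_integral (law t) (step_value v t) (\<integral>\<omega>. reward t \<omega> + \<alpha> * v (\<omega> (Suc t)) \<partial>P)"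
    unfolding stageval_def
    by (rule has_bochner_integral_transition[OF measurable
        Bochner_Integration.integrable_add[OF integrable_reward v_Suc] integrable])
  then show ?thesis
    by (simp add: integrable_reward v_Suc[simplified] integral_coord[OF v] integrable_coord[OF v])
qed

lemma expected_bellman_residual_sums:
  assumes v: "v \<in> Cp p Om"
  shows "(\<lambda>t. \<alpha> ^ t * (\<integral>u. step_value v t u - v u \<partial>law t)) sums (expected_totrew a P - v x)"
proof -
  let ?v = "\<lambda>t. \<alpha> ^ t * integral\<^sup>L (law t) v"
  have "integral\<^sup>L (law 0) v = v x"
    unfolding law_0 using start Cp_borel_measurable[OF v] by (intro integral_return) auto
  then have "(\<lambda>t. ?v (Suc t) - ?v t) sums (0 - v x)"
    using telescope_sums[OF discounted_expectation_tendsto_0[OF v]] by simp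
  from sums_add[OF expected_totrew_sums this]
  have "(\<lambda>t. \<alpha> ^ t * (\<integral>\<omega>. reward t \<omega> \<partial>P) + (?v (Suc t) - ?v t)) sums (expected_totrew a P - v x)"
    by simp
  also have "(\<lambda>t. \<alpha> ^ t * (\<integral>\<omega>. reward t \<omega> \<partial>P) + (?v (Suc t) - ?v t)) =
      (\<lambda>t. \<alpha> ^ t * (\<integral>u. step_value v t u - v u \<partial>law t))"
  proof
    fix t
    have "(\<integral>u. step_value v t u - v u \<partial>law t) =
      (\<integral>\<omega>. reward t \<omega> \<partial>P) + \<alpha> * integral\<^sup>L (law (Suc t)) v - integral\<^sup>L (law t) v"
      using has_bochner_integral_step_value[OF v, of t] integrable_Cp[OF v law_M1p, of t]
      by (simp add: has_bochner_integral_iff)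
    then show "\<alpha> ^ t * (\<integral>\<omega>. reward t \<omega> \<partial>P) + (?v (Suc t) - ?v t) = \<alpha> ^ t * (\<integral>u. step_value v t u - v u \<partial>law t)"
      by (simp only: power_Suc2 distrib_left right_diff_distrib mult.assoc)
  qed
  finally show ?thesis .
qed

lemma value_le_expected_totrew:
  assumes v: "v \<in> Cp p Om" and le: "\<And>t u. u \<in> Om \<Longrightarrow> v u \<le> step_value v t u"
  shows "v x \<le> expected_totrew a P"
proof -
  have "0 \<le> \<alpha> ^ t * (\<integral>u. step_value v t u - v u \<partial>law t)" for t
    using alpha le by (intro mult_nonneg_nonneg integral_nonneg_AE AE_I2) auto
  from sums_le[OF this sums_zero expected_bellman_residual_sums[OF v]] show ?thesis by simp
qed

lemma expected_totrew_le_value: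
  assumes v: "v \<in> Cp p Om" and le: "\<And>t u. u \<in> Om \<Longrightarrow> step_value v t u \<le> v u"
  shows "expected_totrew a P \<le> v x"
proof -
  have "0 \<le> (\<integral>u. - (step_value v t u - v u) \<partial>law t)" for t
    using le by (intro integral_nonneg_AE AE_I2) simp
  then have "(\<integral>u. step_value v t u - v u \<partial>law t) \<le> 0" for t
    unfolding Bochner_Integration.integral_minus by (simp only: neg_0_le_iff_le)
  then have "\<alpha> ^ t * (\<integral>u. step_value v t u - v u \<partial>law t) \<le> 0" for t
    using alpha by (intro mult_nonneg_nonpos) auto
  from sums_le[OF this expected_bellman_residual_sums[OF v] sums_zero] show ?thesis by simp
qed

end

section \<open>Verification\<close>

context robust_mdp
begin

lemma robust_pathI:
  assumes "x \<in> Om" "a \<in> Apol Om A" "\<And>t. K t \<in> Kset Om Pc (a t)"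
  shows "robust_path Om A Pc r rho0 rhoA p CP Cr L \<alpha> x K a"
proof (intro robust_path.intro robust_path_axioms.intro)
  show "robust_mdp Om A Pc r rho0 rhoA p CP Cr L \<alpha>" by (rule robust_mdp_axioms)
  show "kernel_path Om x K" using assms by (intro kernel_path.intro) (auto simp: Kset_def)
qed (use assms in \<open>auto simp: Kset_def\<close>)

lemma Pfrak_eq: "Pfrak Om Pc x a = {pathmeas Om x K | K. \<forall>t. K t \<in> Kset Om Pc (a t)}"
  by (simp add: Pfrak_def Kset_def)

lemma optkernel_pathmeas_Pfrak:
  assumes "optimal_kernel v P0" "a \<in> Apol Om A"
  shows "pathmeas Om x (\<lambda>t y. P0 (y, a t y)) \<in> Pfrak Om Pc x a"
  using optkernel_Kset[OF assms(1)] assms(2) unfolding Pfrak_eq Apol_def by blast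

lemma bdd_below_expected_totrew:
  assumes x: "x \<in> Om" and a: "a \<in> Apol Om A"
  shows "bdd_below (expected_totrew a ` Pfrak Om Pc x a)"
proof (rule bdd_belowI2)
  fix Q assume "Q \<in> Pfrak Om Pc x a"
  then obtain K where Q_eq: "Q = pathmeas Om x K" and K_Kset: "\<And>t. K t \<in> Kset Om Pc (a t)"
    by (auto simp: Pfrak_eq)
  interpret robust_path Om A Pc r rho0 rhoA p CP Cr L \<alpha> x K a by (rule robust_pathI[OF x a K_Kset])
  show "- (\<Sum>t. reward_bound x t) \<le> expected_totrew a Q"
    using abs_expected_totrew_le unfolding Q_eq by linarith
qed

context
  fixes v :: "'x \<Rightarrow> real"
  assumes v: "v \<in> Cp p Om" and fixed: "\<And>x. x \<in> Om \<Longrightarrow> \<T> v x = v x"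
begin

lemma expected_totrew_optkernel_le:
  assumes P0: "optimal_kernel v P0" and a: "a \<in> Apol Om A" and x: "x \<in> Om"
  shows "expected_totrew a (pathmeas Om x (\<lambda>t y. P0 (y, a t y))) \<le> v x"
proof -
  have a_Aloc: "a t \<in> Aloc Om A" for t using a by (simp add: Apol_def)
  interpret robust_path Om A Pc r rho0 rhoA p CP Cr L \<alpha> x "\<lambda>t y. P0 (y, a t y)" a
    by (rule robust_pathI[OF x a optkernel_Kset[OF P0 a_Aloc]])
  show ?thesis
  proof (rule expected_totrew_le_value[OF v])
    fix t u assume u: "u \<in> Om"
    show "stage_value v u (a t u) (P0 (u, a t u)) \<le> v u"
      using optkernelD(3)[OF P0 u a_in[OF u]] worst_value_le_Tb[OF v u a_in[OF u]] fixed[OF u] by simp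
  qed
qed

lemma le_expected_totrew_optaction:
  assumes as: "optimal_action v as" and x: "x \<in> Om" and Q: "Q \<in> Pfrak Om Pc x (\<lambda>t. as)"
  shows "v x \<le> expected_totrew (\<lambda>t. as) Q"
proof -
  obtain K where Q_eq: "Q = pathmeas Om x K" and K_Kset: "\<And>t. K t \<in> Kset Om Pc as"
    using Q by (auto simp: Pfrak_eq)
  have "(\<lambda>t. as) \<in> Apol Om A" using as by (simp add: optaction_iff Apol_def)
  then interpret robust_path Om A Pc r rho0 rhoA p CP Cr L \<alpha> x K "\<lambda>t. as" by (rule robust_pathI[OF x _ K_Kset])
  show ?thesis
    unfolding Q_eq
  proof (rule value_le_expected_totrew[OF v])
    fix t u assume u: "u \<in> Om"
    have "v u = worst_value v u (as u)"
      using as u fixed by (simp add: optaction_iff)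
    also have "\<dots> \<le> stage_value v u (as u) (K t u)"
      by (rule worst_value_le[OF v u a_in[OF u] K_Pc[OF u]])
    finally show "v u \<le> stage_value v u (as u) (K t u)" .
  qed
qed

lemma global_optimality:
  assumes P0: "optimal_kernel v P0" and as: "optimal_action v as" and x: "x \<in> Om"
  shows "pathmeas Om x (\<lambda>t y. P0 (y, as y)) \<in> Pfrak Om Pc x (\<lambda>t. as)"
    "expected_totrew (\<lambda>t. as) (pathmeas Om x (\<lambda>t y. P0 (y, as y))) = v x"
    "(INF Q\<in>Pfrak Om Pc x (\<lambda>t. as). expected_totrew (\<lambda>t. as) Q) = v x"
    "Vfun Om A Pc r \<alpha> x = v x"
proof -
  let ?Ps = "pathmeas Om x (\<lambda>t y. P0 (y, as y))"
  have policy: "(\<lambda>t. as) \<in> Apol Om A" using as by (simp add: optaction_iff Apol_def)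
  show mem: "?Ps \<in> Pfrak Om Pc x (\<lambda>t. as)"
    by (rule optkernel_pathmeas_Pfrak[OF P0 policy])
  show Ps: "expected_totrew (\<lambda>t. as) ?Ps = v x"
    using expected_totrew_optkernel_le[OF P0 policy x] le_expected_totrew_optaction[OF as x mem] by simp
  show INF: "(INF Q\<in>Pfrak Om Pc x (\<lambda>t. as). expected_totrew (\<lambda>t. as) Q) = v x"
  proof (rule cInf_eq_minimum)
    show "v x \<in> expected_totrew (\<lambda>t. as) ` Pfrak Om Pc x (\<lambda>t. as)"
      using Ps mem by (intro image_eqI[of _ _ ?Ps]) simp_all
  qed (use le_expected_totrew_optaction[OF as x] in blast)
  show "Vfun Om A Pc r \<alpha> x = v x"
    unfolding Vfun_def
  proof (rule cSup_eq_maximum)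
    show "v x \<in> (\<lambda>a. INF Q\<in>Pfrak Om Pc x a. expected_totrew a Q) ` Apol Om A"
      using INF policy by (intro image_eqI[of _ _ "\<lambda>t. as"]) simp_all
    fix z assume "z \<in> (\<lambda>a. INF Q\<in>Pfrak Om Pc x a. expected_totrew a Q) ` Apol Om A"
    then obtain a where a: "a \<in> Apol Om A" "z = (INF Q\<in>Pfrak Om Pc x a. expected_totrew a Q)" by auto
    have "z \<le> expected_totrew a (pathmeas Om x (\<lambda>t y. P0 (y, a t y)))"
      unfolding a(2) by (intro cINF_lower bdd_below_expected_totrew[OF x a(1)]
        optkernel_pathmeas_Pfrak[OF P0 a(1)])
    also have "\<dots> \<le> v x" by (rule expected_totrew_optkernel_le[OF P0 a(1) x])
    finally show "z \<le> v x" .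
  qed
qed

end

end

theorem mainTheorem1:
  fixes Om :: "'x::euclidean_space set" and A :: "'u::euclidean_space set"
    and Pc :: "'x \<Rightarrow> 'u \<Rightarrow> 'x measure set"
    and r :: "'x \<Rightarrow> 'u \<Rightarrow> 'x \<Rightarrow> real"
    and rho0 rhoA :: "real \<Rightarrow> ennreal"
    and p :: nat and CP Cr L \<alpha> :: real
  assumes p01: "p \<in> {0, 1}"
    and Om: "closed Om" "Om \<noteq> {}"
    and A: "compact A" "A \<noteq> {}"
    \<comment> \<open>(A1)(i)\<close>
    and A1_ne_cpt: "\<forall>x\<in>Om. \<forall>a\<in>A. Pc x a \<noteq> {} \<and> compactin (tau p Om) (Pc x a)"
    and A1_uhc: "uhc (top_of_set (Om \<times> A)) (tau p Om) (\<lambda>(x, a). Pc x a)"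
    and A1_lhc: "lhc (top_of_set (Om \<times> A)) (tau p Om) (\<lambda>(x, a). Pc x a)"
    \<comment> \<open>(A1)(ii)\<close>
    and CP: "CP \<ge> 1"
    and A1_mom: "\<forall>x\<in>Om. \<forall>a\<in>A. \<forall>Q\<in>Pc x a.
        nn_integral Q (\<lambda>y. ennreal (1 + norm y ^ p)) \<le> ennreal (CP * (1 + norm x ^ p))"
    \<comment> \<open>(A2)(i)\<close>
    and r_cont: "continuous_on (Om \<times> A \<times> Om) (\<lambda>(x, a, y). r x a y)"
    \<comment> \<open>(A2)(ii)\<close>
    and L: "L > 0"
    and rho0: "rho0 0 = 0" "(rho0 \<longlongrightarrow> 0) (at_right 0)"
    and rhoA: "rhoA 0 = 0" "(rhoA \<longlongrightarrow> 0) (at_right 0)"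
    and r_mod: "\<forall>x0\<in>Om. \<forall>x0'\<in>Om. \<forall>x1\<in>Om. \<forall>a\<in>A. \<forall>a'\<in>A.
        ennreal \<bar>r x0 a x1 - r x0' a' x1\<bar>
          \<le> ennreal (L * (1 + norm x1 ^ p)) * (rho0 (dist x0 x0') + rhoA (dist a a'))"
    \<comment> \<open>(A2)(iii)\<close>
    and Cr: "Cr \<ge> 1"
    and r_growth: "\<forall>x0\<in>Om. \<forall>a\<in>A. \<forall>x1\<in>Om. \<bar>r x0 a x1\<bar> \<le> Cr * (1 + norm x0 ^ p + norm x1 ^ p)"
    \<comment> \<open>(A2)(iv)\<close>
    and alpha: "0 < \<alpha>" "\<alpha> < 1 / CP"
  shows
    \<comment> \<open>(i)\<close>
    "(\<forall>v\<in>Cp p Om.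
        (\<exists>P0. optkernel Om A Pc r \<alpha> v P0) \<and>
        (\<exists>as. optaction Om A Pc r \<alpha> v as) \<and>
        (\<forall>P0 as. optkernel Om A Pc r \<alpha> v P0 \<longrightarrow> optaction Om A Pc r \<alpha> v as \<longrightarrow>
           (let Ps = (\<lambda>x. P0 (x, as x)) in
              Ps \<in> Kset Om Pc as \<and>
              (\<forall>x\<in>Om.
                 Tb A Pc r \<alpha> v x
                   = (SUP a'\<in>Aloc Om A. INF K\<in>Kset Om Pc a'. stageval r \<alpha> v x (a' x) (K x)) \<and>
                 Tb A Pc r \<alpha> v x
                   = (INF K\<in>Kset Om Pc as. stageval r \<alpha> v x (as x) (K x)) \<and>
                 Tb A Pc r \<alpha> v x = stageval r \<alpha> v x (as x) (Ps x))))) \<and>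
     \<comment> \<open>(ii)\<close>
     (\<forall>v\<in>Cp p Om. Tb A Pc r \<alpha> v \<in> Cp p Om) \<and>
     (\<forall>v\<in>Cp p Om. \<forall>w\<in>Cp p Om.
        cpnorm p Om (\<lambda>x. Tb A Pc r \<alpha> v x - Tb A Pc r \<alpha> w x) \<le> \<alpha> * CP * cpnorm p Om (\<lambda>x. v x - w x)) \<and>
     (\<exists>v\<in>Cp p Om. (\<forall>x\<in>Om. Tb A Pc r \<alpha> v x = v x) \<and>
        (\<forall>w\<in>Cp p Om. (\<forall>x\<in>Om. Tb A Pc r \<alpha> w x = w x) \<longrightarrow> (\<forall>x\<in>Om. w x = v x)) \<and>
        (\<forall>v0\<in>Cp p Om. (\<lambda>n. cpnorm p Om (\<lambda>x. (Tb A Pc r \<alpha> ^^ n) v0 x - v x)) \<longlonglongrightarrow> 0)) \<and>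
     \<comment> \<open>(iii)\<close>
     (\<forall>v\<in>Cp p Om. (\<forall>x\<in>Om. Tb A Pc r \<alpha> v x = v x) \<longrightarrow>
        (\<forall>P0 as. optkernel Om A Pc r \<alpha> v P0 \<longrightarrow> optaction Om A Pc r \<alpha> v as \<longrightarrow>
           (let Ps = (\<lambda>x. P0 (x, as x)); astar = (\<lambda>t::nat. as) in
            \<forall>x\<in>Om. pathmeas Om x (\<lambda>t. Ps) \<in> Pfrak Om Pc x astar \<and>
              integral\<^sup>L (pathmeas Om x (\<lambda>t. Ps)) (totrew r \<alpha> astar)
                = (INF P\<in>Pfrak Om Pc x astar. integral\<^sup>L P (totrew r \<alpha> astar)) \<and>
              (INF P\<in>Pfrak Om Pc x astar. integral\<^sup>L P (totrew r \<alpha> astar)) = Vfun Om A Pc r \<alpha> x \<and>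
              Vfun Om A Pc r \<alpha> x = v x)))"
proof -
  interpret robust_mdp Om A Pc r rho0 rhoA p CP Cr L \<alpha>
    by (rule robust_mdp.intro) (fact assms)+
  have "(\<lambda>x. P0 (x, as x)) \<in> Kset Om Pc as"
    if "optkernel Om A Pc r \<alpha> v P0" "optaction Om A Pc r \<alpha> v as" for v P0 as
    using that optkernel_Kset optaction_iff by blast
  then show ?thesis
    unfolding Let_def
    using optkernel_exists optaction_exists local_optimality Tb_Cp Tb_contraction bellman.fixed_point_theorem
      global_optimality
    by (intro conjI ballI allI impI) simp_all
qed

end
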